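(* Let $F$ be a totally ordered field (with its order topology) that is either uncountable or a countable subfield of $\mathbb{R}$, and let $X$ be a zero-dimensional Hausdorff space. Then the following statements are true: (1) For each $p\in\beta_0X$, $O^{p,F}_c$ is a $Z_{F_c}$-ideal in $C_c(X,F)$ contained in $M^{p,F}_c$. (2) For each $p\in\beta_0X$, $O^{p,F}_c=\{f\in C_c(X,F): \text{there exists an open neighbourhood } V \text{ of } p \text{ in } \beta_0X \text{ such that } Z_c(f)\supset V\cap X\}$. (3) For $p\in\beta_0X$ and $f\in C_c(X,F)$, $f\in O^{p,F}_c$ if and only if there exists $g\in C_c(X,F)\setminus M^{p,F}_c$ such that $f\cdot g=0$; hence each non-zero element of $O^{p,F}_c$ is a divisor of zero in $C_c(X,F)$. Indeed, $O^{p,F}_c$ is a $z^o$-ideal in $C_c(X,F)$. (4) An ideal $I$ in $C_c(X,F)$ is extendable to a unique maximal ideal if and only if there exists $p\in\beta_0X$ such that $O^{p,F}_c\subset I$. (5) For $p\in\beta_0X$, $O^{p,F}_c$ is a fixed ideal if and only if $p\in X$.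
   Context: A totally ordered field $F$ carries its order (interval) topology. $C_c(X,F)$ is the commutative ring with unity (pointwise operations) of all continuous functions $f:X\to F$ whose range $f(X)$ is countable, and $Z_c(f)=\{x\in X: f(x)=0\}$. "Ideal" always means proper ideal. A space is zero-dimensional if it has a base of clopen sets. The Banaschewski compactification $\beta_0X$ of a Hausdorff zero-dimensional space $X$ is the (unique up to equivalence) zero-dimensional Hausdorff compactification of $X$ such that every continuous map from $X$ to a compact Hausdorff zero-dimensional space $Y$ extends to a continuous map $\beta_0X\to Y$; $X$ is regarded as a dense subspace of $\beta_0X$. For $p\in\beta_0X$: $M^{p,F}_c=\{f\in C_c(X,F): p\in\mathrm{cl}_{\beta_0X}Z_c(f)\}$ (these are exactly the maximal ideals of $C_c(X,F)$), and $O^{p,F}_c=\{f\in C_c(X,F): \mathrm{cl}_{\beta_0X}Z_c(f)\text{ is a neighbourhood of } p \text{ in } \beta_0X\}$. An ideal $I$ in $C_c(X,F)$ is a $Z_{F_c}$-ideal if, whenever $f\in C_c(X,F)$ and $Z_c(f)=Z_c(g)$ for some $g\in I$, then $f\in I$. An ideal $I$ is fixed if $\bigcap_{f\in I}Z_c(f)\neq\emptyset$. An ideal $I$ in a commutative ring $A$ with unity is a $z^o$-ideal if for each $a\in I$ one has $P_a\subset I$, where $P_a$ is the intersection of all minimal prime ideals of $A$ containing $a$. *)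

theory Defs
  imports "HOL-Analysis.Analysis" "HOL-Algebra.Ideal"
begin

section \<open>The ordered field\<close>

text \<open>
  A totally ordered field with its order topology is a type of sort
  \<open>{linordered_field, linorder_topology}\<close>. Up to isomorphism of ordered fields, it is a
  subfield of the reals iff it has an order preserving field homomorphism into the reals.
\<close>

definition real_subfield :: "'f::linordered_field itself \<Rightarrow> bool" where
  "real_subfield _ \<longleftrightarrow>
     (\<exists>\<phi> :: 'f \<Rightarrow> real. \<phi> 1 = 1 \<and> (\<forall>x y. \<phi> (x + y) = \<phi> x + \<phi> y) \<and>
        (\<forall>x y. \<phi> (x * y) = \<phi> x * \<phi> y) \<and> strict_mono \<phi>)"


section \<open>Zero-dimensional spaces and the Banaschewski compactification\<close>

definition zero_dimensional_space :: "'a topology \<Rightarrow> bool" where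
  "zero_dimensional_space X \<longleftrightarrow>
     (\<exists>\<B>. (\<forall>U\<in>\<B>. openin X U \<and> closedin X U) \<and>
          openin X = arbitrary union_of (\<lambda>U. U \<in> \<B>))"

text \<open>
  \<open>banaschewski X B e\<close>: the space \<open>B\<close> together with the embedding \<open>e\<close> of \<open>X\<close> is a Banaschewski
  compactification of \<open>X\<close>. A point \<open>x\<close> of \<open>X\<close> is identified with \<open>e x\<close>. HOL cannot quantify over
  the type carrying the test space \<open>Y\<close>, so one fixed type is used. This loses nothing: by
  \<open>banaschewski_extension\<close> below, maps into test spaces over an arbitrary type then extend as well
  (and \<open>banaschewski_exists\<close> provides such a compactification).
\<close>

definition banaschewski :: "'a topology \<Rightarrow> 'b topology \<Rightarrow> ('a \<Rightarrow> 'b) \<Rightarrow> bool" where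
  "banaschewski X B e \<longleftrightarrow>
     compact_space B \<and> Hausdorff_space B \<and> zero_dimensional_space B \<and>
     embedding_map X B e \<and> B closure_of (e ` topspace X) = topspace B \<and>
     (\<forall>(Y :: 'a set set topology) f.
        compact_space Y \<longrightarrow> Hausdorff_space Y \<longrightarrow> zero_dimensional_space Y \<longrightarrow> continuous_map X Y f \<longrightarrow>
        (\<exists>g. continuous_map B Y g \<and> (\<forall>x\<in>topspace X. g (e x) = f x)))"

lemma zero_dimensional_space_alt:
  "zero_dimensional_space X \<longleftrightarrow>
     (\<forall>U x. openin X U \<and> x \<in> U \<longrightarrow> (\<exists>V. openin X V \<and> closedin X V \<and> x \<in> V \<and> V \<subseteq> U))"
  unfolding zero_dimensional_space_def openin_topology_base_unique
proof
  assume "\<forall>U x. openin X U \<and> x \<in> U \<longrightarrow> (\<exists>V. openin X V \<and> closedin X V \<and> x \<in> V \<and> V \<subseteq> U)"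
  then show "\<exists>\<B>. (\<forall>U\<in>\<B>. openin X U \<and> closedin X U) \<and>
     (\<forall>V. V \<in> \<B> \<longrightarrow> openin X V) \<and> (\<forall>U x. openin X U \<and> x \<in> U \<longrightarrow> (\<exists>V. V \<in> \<B> \<and> x \<in> V \<and> V \<subseteq> U))"
    by (intro exI[of _ "{V. openin X V \<and> closedin X V}"]) auto
qed meson

lemma zero_dimensional_space_iff_dim_le_0: "zero_dimensional_space X \<longleftrightarrow> X dim_le 0"
  unfolding zero_dimensional_space_alt dimension_le_0_neighbourhood_base_of_clopen
  by (subst open_neighbourhood_base_of) (auto, (meson | blast)+)

lemma extend_from_dense:
  assumes dense: "B closure_of (e ` topspace X) = topspace B"
    and e: "\<And>x. x \<in> topspace X \<Longrightarrow> e x \<in> topspace B"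
    and clopen: "\<And>C. openin X C \<Longrightarrow> closedin X C \<Longrightarrow>
        \<exists>D. openin B D \<and> closedin B D \<and> (\<forall>x\<in>topspace X. e x \<in> D \<longleftrightarrow> x \<in> C)"
    and Y: "compact_space Y" "Hausdorff_space Y" "zero_dimensional_space Y"
    and f: "continuous_map X Y f"
  shows "\<exists>g. continuous_map B Y g \<and> (\<forall>x\<in>topspace X. g (e x) = f x)"
proof -
  define K where "K = {C. openin Y C \<and> closedin Y C}"
  have "\<exists>D. openin B D \<and> closedin B D \<and> (\<forall>x\<in>topspace X. e x \<in> D \<longleftrightarrow> f x \<in> C)" if "C \<in> K" for C
    using clopen[of "{x \<in> topspace X. f x \<in> C}"] that f
    by (simp add: K_def openin_continuous_map_preimage closedin_continuous_map_preimage)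
  then obtain D where D: "\<And>C. C \<in> K \<Longrightarrow> openin B (D C)" "\<And>C. C \<in> K \<Longrightarrow> closedin B (D C)"
      "\<And>C x. C \<in> K \<Longrightarrow> x \<in> topspace X \<Longrightarrow> e x \<in> D C \<longleftrightarrow> f x \<in> C"
    by metis
  have hit: "\<exists>x\<in>topspace X. e x \<in> U" if "openin B U" "b \<in> U" for U b
  proof -
    have "b \<in> B closure_of (e ` topspace X)" using dense that openin_subset by blast
    then show ?thesis using that by (auto simp: in_closure_of)
  qed
  have fX: "f x \<in> topspace Y" if "x \<in> topspace X" for x
    using f that by (auto simp: continuous_map_def)
  have "\<exists>y\<in>topspace Y. \<forall>C\<in>K. b \<in> D C \<longrightarrow> y \<in> C" if b: "b \<in> topspace B" for b
  proof -
    define \<U> where "\<U> = {C \<in> K. b \<in> D C}"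
    have top: "topspace Y \<in> \<U>"
    proof -
      have "topspace Y \<in> K" by (simp add: K_def)
      moreover have "b \<in> D (topspace Y)"
      proof (rule ccontr)
        assume "b \<notin> D (topspace Y)"
        then obtain x where "x \<in> topspace X" "e x \<in> topspace B - D (topspace Y)"
          using hit[of "topspace B - D (topspace Y)" b] b D(2)[OF \<open>topspace Y \<in> K\<close>] by blast
        then show False using D(3)[OF \<open>topspace Y \<in> K\<close>] fX by auto
      qed
      ultimately show ?thesis by (simp add: \<U>_def)
    qed
    have "\<Inter>\<U> \<noteq> {}"
    proof -
      have fip: "\<Inter>\<F> \<noteq> {}" if \<F>: "finite \<F>" "\<F> \<subseteq> \<U>" for \<F>
      proof -
        have "openin B (topspace B \<inter> \<Inter>(D ` \<F>))"
          using \<F> by (cases "\<F> = {}") (auto simp: \<U>_def intro!: openin_Int openin_Inter D)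
        then obtain x where "x \<in> topspace X" "e x \<in> topspace B \<inter> \<Inter>(D ` \<F>)"
          using hit[of _ b] b \<F> by (force simp: \<U>_def)
        then have "f x \<in> \<Inter>\<F>" using D(3) \<F> by (auto simp: \<U>_def)
        then show ?thesis by blast
      qed
      show ?thesis
        using Y(1) fip unfolding compact_space_fip
        by (metis (mono_tags, lifting) K_def \<U>_def mem_Collect_eq)
    qed
    then obtain y where "y \<in> \<Inter>\<U>" by blast
    then show ?thesis using top by (auto simp: \<U>_def)
  qed
  then obtain g where g: "\<And>b. b \<in> topspace B \<Longrightarrow> g b \<in> topspace Y"
      "\<And>b C. b \<in> topspace B \<Longrightarrow> C \<in> K \<Longrightarrow> b \<in> D C \<Longrightarrow> g b \<in> C"
    by metis
  have gD: "{b \<in> topspace B. g b \<in> C} = D C" if C: "C \<in> K" for C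
  proof
    show "D C \<subseteq> {b \<in> topspace B. g b \<in> C}"
      using g(2) D(1) C openin_subset by fastforce
    show "{b \<in> topspace B. g b \<in> C} \<subseteq> D C"
    proof (rule ccontr)
      assume "\<not> ?thesis"
      then obtain b where b: "b \<in> topspace B" "g b \<in> C" "b \<notin> D C" by blast
      let ?C = "topspace Y - C"
      have C': "?C \<in> K" using C by (auto simp: K_def)
      have "b \<notin> D ?C" using g(2)[OF b(1) C'] b(2) by blast
      then obtain x where "x \<in> topspace X" "e x \<in> (topspace B - D C) - D ?C"
        using hit[of "(topspace B - D C) - D ?C" b] b D(2)[OF C] D(2)[OF C'] openin_diff by blast
      then show False using D(3)[OF C] D(3)[OF C'] fX by auto
    qed
  qed
  have "continuous_map B Y g"
  proof -
    have "openin Y = arbitrary union_of (\<lambda>U. U \<in> K)"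
      using Y(3) unfolding zero_dimensional_space_alt openin_topology_base_unique K_def by auto
    moreover have "openin B {b \<in> topspace B. g b \<in> U}" if U: "openin Y U" for U
    proof (subst openin_subopen, clarify)
      fix b assume b: "b \<in> topspace B" "g b \<in> U"
      then obtain V where V: "openin Y V" "closedin Y V" "g b \<in> V" "V \<subseteq> U"
        using Y(3) U unfolding zero_dimensional_space_alt by meson
      then have "V \<in> K" by (simp add: K_def)
      show "\<exists>T. openin B T \<and> b \<in> T \<and> T \<subseteq> {b \<in> topspace B. g b \<in> U}"
        by (intro exI[of _ "D V"]) (use gD[OF \<open>V \<in> K\<close>] D(1)[OF \<open>V \<in> K\<close>] V b in blast)
    qed
    ultimately show ?thesis using g(1) by (auto simp: continuous_map_def)
  qed
  moreover have "g (e x) = f x" if x: "x \<in> topspace X" for x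
  proof (rule ccontr)
    assume ne: "g (e x) \<noteq> f x"
    then obtain U where U: "openin Y U" "f x \<in> U" "g (e x) \<notin> U"
      using Y(2) fX[OF x] g(1)[OF e[OF x]] unfolding Hausdorff_space_def disjnt_def by blast
    then obtain V where V: "openin Y V" "closedin Y V" "f x \<in> V" "V \<subseteq> U"
      using Y(3) unfolding zero_dimensional_space_alt by meson
    then have "V \<in> K" by (simp add: K_def)
    then show False using D(3) g(2) e x V U by blast
  qed
  ultimately show ?thesis by blast
qed

lemma zero_dimensional_space_discrete: "zero_dimensional_space (discrete_topology S)"
  unfolding zero_dimensional_space_alt by auto

theorem banaschewski_extension:
  assumes "banaschewski X B e"
    and "compact_space Y" "Hausdorff_space Y" "zero_dimensional_space Y" "continuous_map X Y f"
  shows "\<exists>g. continuous_map B Y g \<and> (\<forall>x\<in>topspace X. g (e x) = f x)"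
proof (rule extend_from_dense[OF _ _ _ assms(2-5)])
  show "B closure_of (e ` topspace X) = topspace B"
    using assms(1) by (simp add: banaschewski_def)
  have "embedding_map X B e" using assms(1) by (simp add: banaschewski_def)
  then have "continuous_map X B e"
    unfolding embedding_map_def
    by (rule continuous_map_into_fulltopology[OF homeomorphic_imp_continuous_map])
  then show eB: "e x \<in> topspace B" if "x \<in> topspace X" for x
    using that continuous_map_image_subset_topspace by blast
  fix C assume C: "openin X C" "closedin X C"
  let ?Z = "discrete_topology {{}, UNIV} :: 'a set set topology"
  define h where "h x = (if x \<in> C then UNIV else {} :: 'a set set)" for x
  have "continuous_map X ?Z h"
  proof -
    have "{x \<in> topspace X. h x \<in> U} =
        (if UNIV \<in> U then C else {}) \<union> (if {} \<in> U then topspace X - C else {})" for U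
      using openin_subset[OF C(1)] by (auto simp: h_def)
    then show ?thesis using C by (auto simp: continuous_map_def h_def openin_diff)
  qed
  moreover have "compact_space ?Z" "Hausdorff_space ?Z" "zero_dimensional_space ?Z"
    by (simp_all add: compact_space_discrete_topology zero_dimensional_space_discrete)
  ultimately obtain g where g: "continuous_map B ?Z g" "\<forall>x\<in>topspace X. g (e x) = h x"
    using assms(1) unfolding banaschewski_def by blast
  show "\<exists>D. openin B D \<and> closedin B D \<and> (\<forall>x\<in>topspace X. e x \<in> D \<longleftrightarrow> x \<in> C)"
  proof (intro exI conjI)
    show "openin B {b \<in> topspace B. g b \<in> {UNIV}}" "closedin B {b \<in> topspace B. g b \<in> {UNIV}}"
      by (rule openin_continuous_map_preimage[OF g(1)] closedin_continuous_map_preimage[OF g(1)]; simp)+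
    show "\<forall>x\<in>topspace X. e x \<in> {b \<in> topspace B. g b \<in> {UNIV}} \<longleftrightarrow> x \<in> C"
      using g(2) eB by (auto simp: h_def)
  qed
qed

theorem banaschewski_exists:
  fixes X :: "'a topology"
  assumes "Hausdorff_space X" "zero_dimensional_space X"
  shows "\<exists>(B :: ('a set \<Rightarrow> bool) topology) e. banaschewski X B e"
proof -
  define P where "P = product_topology (\<lambda>_ :: 'a set. discrete_topology (UNIV :: bool set)) UNIV"
  define e where "e x = (\<lambda>C. x \<in> C \<and> openin X C \<and> closedin X C)" for x
  define B where "B = subtopology P (P closure_of (e ` topspace X))"
  have topP: "topspace P = UNIV" by (simp add: P_def)
  have clopP: "openin P {b. b C}" "closedin P {b. b C}" for C
    using openin_continuous_map_preimage[OF continuous_map_product_projection[of C UNIV "\<lambda>_. discrete_topology (UNIV :: bool set)"], of "{True}"]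
      closedin_continuous_map_preimage[OF continuous_map_product_projection[of C UNIV "\<lambda>_. discrete_topology (UNIV :: bool set)"], of "{True}"]
    by (simp_all add: P_def)
  have "compact_space P"
    by (simp add: P_def compact_space_product_topology compact_space_discrete_topology)
  then have 1: "compact_space B"
    unfolding B_def by (simp add: closedin_compact_space compact_space_subtopology)
  have 2: "Hausdorff_space B"
    unfolding B_def P_def
    by (intro Hausdorff_space_subtopology) (simp add: Hausdorff_space_product_topology)
  have "zero_dimensional_space P"
    unfolding zero_dimensional_space_alt
  proof (intro allI impI, elim conjE)
    fix U x assume "openin P U" "x \<in> U"
    then obtain W where W: "x \<in> (\<Pi>\<^sub>E i\<in>UNIV. W i)" "finite {i. W i \<noteq> UNIV}" "(\<Pi>\<^sub>E i\<in>UNIV. W i) \<subseteq> U"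
      using product_topology_open_contains_basis[of "\<lambda>_. discrete_topology (UNIV :: bool set)" UNIV U x]
      unfolding P_def by auto
    have "openin P (\<Pi>\<^sub>E i\<in>UNIV. W i)" unfolding P_def
      by (rule product_topology_basis) (use W in auto)
    moreover have "closedin P (\<Pi>\<^sub>E i\<in>UNIV. W i)" unfolding P_def
      by (simp add: closedin_product_topology)
    ultimately show "\<exists>V. openin P V \<and> closedin P V \<and> x \<in> V \<and> V \<subseteq> U" using W by blast
  qed
  then have 3: "zero_dimensional_space B"
    unfolding B_def by (simp add: zero_dimensional_space_iff_dim_le_0 dimension_le_subtopology)
  have eB: "e ` topspace X \<subseteq> P closure_of (e ` topspace X)"
    by (simp add: closure_of_subset topP)
  have 5: "B closure_of (e ` topspace X) = topspace B"
    using eB by (simp add: B_def closure_of_subtopology topP inf.absorb2)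
  have pre: "{x \<in> topspace X. e x C} = (if openin X C \<and> closedin X C then C else {})" for C
    using openin_subset by (auto simp: e_def)
  have "continuous_map X P e"
    unfolding P_def continuous_map_componentwise_UNIV
  proof
    fix C
    have "{x \<in> topspace X. e x C \<in> U} =
        (if True \<in> U then {x \<in> topspace X. e x C} else {}) \<union>
        (if False \<in> U then topspace X - {x \<in> topspace X. e x C} else {})" for U
      by auto metis+
    moreover have "openin X {x \<in> topspace X. e x C}" "closedin X {x \<in> topspace X. e x C}"
      by (simp_all add: pre)
    ultimately show "continuous_map X (discrete_topology UNIV) (\<lambda>x. e x C)"
      by (auto simp: continuous_map_def openin_diff)
  qed
  moreover have inj: "inj_on e (topspace X)"
  proof (rule inj_onI, rule ccontr)
    fix x y assume xy: "x \<in> topspace X" "y \<in> topspace X" "e x = e y" "x \<noteq> y"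
    then obtain U where "openin X U" "x \<in> U" "y \<notin> U"
      using assms(1) unfolding Hausdorff_space_def disjnt_def by blast
    then obtain V where "openin X V" "closedin X V" "x \<in> V" "y \<notin> V"
      using assms(2) unfolding zero_dimensional_space_alt by (metis subsetD)
    then show False using fun_cong[OF xy(3), of V] by (simp add: e_def)
  qed
  moreover have "open_map X (subtopology P (e ` topspace X)) e"
    unfolding open_map_def
  proof (intro allI impI)
    fix U assume U: "openin X U"
    show "openin (subtopology P (e ` topspace X)) (e ` U)"
    proof (subst openin_subopen, clarify)
      fix x assume "x \<in> U"
      then obtain V where V: "openin X V" "closedin X V" "x \<in> V" "V \<subseteq> U"
        using assms(2) U unfolding zero_dimensional_space_alt by meson
      have "openin (subtopology P (e ` topspace X)) ({b. b V} \<inter> e ` topspace X)"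
        using clopP(1) by (auto simp: openin_subtopology)
      moreover have "e x \<in> {b. b V} \<inter> e ` topspace X"
        using V openin_subset[OF V(1)] by (auto simp: e_def)
      moreover have "{b. b V} \<inter> e ` topspace X \<subseteq> e ` U"
        using V by (auto simp: e_def)
      ultimately show "\<exists>T. openin (subtopology P (e ` topspace X)) T \<and> e x \<in> T \<and> T \<subseteq> e ` U"
        by blast
    qed
  qed
  ultimately have "embedding_map X (subtopology P (e ` topspace X)) e"
    by (intro injective_open_imp_embedding_map) (auto simp: continuous_map_in_subtopology)
  then have 4: "embedding_map X B e"
    using eB by (simp add: embedding_map_in_subtopology B_def)
  have 6: "\<exists>g. continuous_map B Y g \<and> (\<forall>x\<in>topspace X. g (e x) = f x)"
    if "compact_space Y" "Hausdorff_space Y" "zero_dimensional_space Y" "continuous_map X Y f"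
    for Y :: "'a set set topology" and f
  proof (rule extend_from_dense[OF 5 _ _ that])
    show "e x \<in> topspace B" if "x \<in> topspace X" for x
      using that eB by (auto simp: B_def topP)
    fix C assume C: "openin X C" "closedin X C"
    let ?D = "{b. b C} \<inter> P closure_of (e ` topspace X)"
    have "openin B ?D" "closedin B ?D"
      using clopP by (auto simp: B_def openin_subtopology closedin_subtopology)
    moreover have "\<forall>x\<in>topspace X. e x \<in> ?D \<longleftrightarrow> x \<in> C"
      using eB C by (auto simp: e_def)
    ultimately show "\<exists>D. openin B D \<and> closedin B D \<and> (\<forall>x\<in>topspace X. e x \<in> D \<longleftrightarrow> x \<in> C)"
      by blast
  qed
  show ?thesis
    unfolding banaschewski_def using 1 2 3 4 5 6 by blast
qed


section \<open>The ring of continuous functions with countable range\<close>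

text \<open>Functions on \<open>X\<close> are represented as functions that are \<open>undefined\<close> outside \<open>topspace X\<close>.\<close>

definition Cc :: "'a topology \<Rightarrow> ('a \<Rightarrow> 'f::{linordered_field,linorder_topology}) ring" where
  "Cc X =
     \<lparr>carrier = {f \<in> extensional (topspace X).
                   continuous_map X euclidean f \<and> countable (f ` topspace X)},
      mult = (\<lambda>f g. \<lambda>x\<in>topspace X. f x * g x),
      one = (\<lambda>x\<in>topspace X. 1),
      zero = (\<lambda>x\<in>topspace X. 0),
      add = (\<lambda>f g. \<lambda>x\<in>topspace X. f x + g x)\<rparr>"

lemma tendsto_abs_iff:
  fixes f :: "'a \<Rightarrow> 'f::{linordered_field,linorder_topology}"
  shows "(f \<longlongrightarrow> l) F \<longleftrightarrow> (\<forall>r>0. \<forall>\<^sub>F x in F. \<bar>f x - l\<bar> < r)"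
proof
  assume L: "(f \<longlongrightarrow> l) F"
  show "\<forall>r>0. \<forall>\<^sub>F x in F. \<bar>f x - l\<bar> < r"
  proof (intro allI impI)
    fix r :: 'f assume "r > 0"
    then have "\<forall>\<^sub>F x in F. l - r < f x" "\<forall>\<^sub>F x in F. f x < l + r"
      using L by (simp_all add: order_tendsto_iff)
    then show "\<forall>\<^sub>F x in F. \<bar>f x - l\<bar> < r"
      by eventually_elim (simp add: abs_less_iff algebra_simps)
  qed
next
  assume R: "\<forall>r>0. \<forall>\<^sub>F x in F. \<bar>f x - l\<bar> < r"
  show "(f \<longlongrightarrow> l) F"
  proof (rule order_tendstoI)
    fix a assume "a < l"
    then have "\<forall>\<^sub>F x in F. \<bar>f x - l\<bar> < l - a" using R by simp
    then show "\<forall>\<^sub>F x in F. a < f x" by eventually_elim (simp add: abs_less_iff)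
  next
    fix a assume "l < a"
    then have "\<forall>\<^sub>F x in F. \<bar>f x - l\<bar> < a - l" using R by simp
    then show "\<forall>\<^sub>F x in F. f x < a" by eventually_elim (simp add: abs_less_iff)
  qed
qed

lemma tendsto_add_field:
  fixes f g :: "'a \<Rightarrow> 'f::{linordered_field,linorder_topology}"
  assumes "(f \<longlongrightarrow> l) F" "(g \<longlongrightarrow> m) F"
  shows "((\<lambda>x. f x + g x) \<longlongrightarrow> l + m) F"
  unfolding tendsto_abs_iff
proof (intro allI impI)
  fix r :: 'f assume "r > 0"
  then have "0 < r / 2" by simp
  then have "\<forall>\<^sub>F x in F. \<bar>f x - l\<bar> < r / 2" "\<forall>\<^sub>F x in F. \<bar>g x - m\<bar> < r / 2"
    using assms[unfolded tendsto_abs_iff] by blast+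
  then show "\<forall>\<^sub>F x in F. \<bar>f x + g x - (l + m)\<bar> < r"
  proof eventually_elim
    case (elim x)
    have "\<bar>f x + g x - (l + m)\<bar> \<le> \<bar>f x - l\<bar> + \<bar>g x - m\<bar>"
      using abs_triangle_ineq[of "f x - l" "g x - m"] by (simp add: algebra_simps)
    also have "\<dots> < r / 2 + r / 2" using elim by (rule add_strict_mono)
    finally show ?case by simp
  qed
qed

lemma tendsto_mult_field:
  fixes f g :: "'a \<Rightarrow> 'f::{linordered_field,linorder_topology}"
  assumes "(f \<longlongrightarrow> l) F" "(g \<longlongrightarrow> m) F"
  shows "((\<lambda>x. f x * g x) \<longlongrightarrow> l * m) F"
  unfolding tendsto_abs_iff
proof (intro allI impI)
  fix r :: 'f assume r: "r > 0"
  define c where "c = \<bar>l\<bar> + \<bar>m\<bar> + 1"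
  have c: "c > 0" "1 \<le> c" by (simp_all add: c_def add_nonneg_pos)
  define d where "d = min 1 (r / c)"
  have d: "d > 0" "d \<le> 1" "d * c \<le> r"
    using r c by (auto simp: d_def min_def field_simps)
  then have "\<forall>\<^sub>F x in F. \<bar>f x - l\<bar> < d" "\<forall>\<^sub>F x in F. \<bar>g x - m\<bar> < d"
    using assms by (simp_all add: tendsto_abs_iff)
  then show "\<forall>\<^sub>F x in F. \<bar>f x * g x - l * m\<bar> < r"
  proof eventually_elim
    case (elim x)
    have "f x * g x - l * m = (f x - l) * (g x - m) + (f x - l) * m + l * (g x - m)"
      by (simp add: algebra_simps)
    then have "\<bar>f x * g x - l * m\<bar> \<le> \<bar>f x - l\<bar> * \<bar>g x - m\<bar> + \<bar>f x - l\<bar> * \<bar>m\<bar> + \<bar>l\<bar> * \<bar>g x - m\<bar>"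
      using abs_triangle_ineq[of "(f x - l) * (g x - m) + (f x - l) * m" "l * (g x - m)"]
        abs_triangle_ineq[of "(f x - l) * (g x - m)" "(f x - l) * m"]
      unfolding abs_mult by linarith
    also have "\<dots> < d * 1 + d * \<bar>m\<bar> + \<bar>l\<bar> * d"
    proof -
      have "\<bar>f x - l\<bar> * \<bar>g x - m\<bar> < d * 1"
        using elim d by (intro mult_strict_mono') auto
      moreover have "\<bar>f x - l\<bar> * \<bar>m\<bar> \<le> d * \<bar>m\<bar>" "\<bar>l\<bar> * \<bar>g x - m\<bar> \<le> \<bar>l\<bar> * d"
        using elim by (auto intro: mult_right_mono mult_left_mono)
      ultimately show ?thesis by linarith
    qed
    also have "\<dots> = d * c" by (simp add: c_def algebra_simps)
    finally show ?case using d by linarith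
  qed
qed

lemma continuous_map_field:
  fixes f g :: "'a \<Rightarrow> 'f::{linordered_field,linorder_topology}"
  assumes "continuous_map X euclidean f" "continuous_map X euclidean g"
  shows "continuous_map X euclidean (\<lambda>x. f x + g x)" "continuous_map X euclidean (\<lambda>x. f x * g x)"
  using assms by (auto simp: continuous_map_atin intro: tendsto_add_field tendsto_mult_field)

lemma Cc_binop_closed:
  assumes "f \<in> carrier (Cc X)" "g \<in> carrier (Cc X)"
    and "continuous_map X euclidean (\<lambda>x. h (f x) (g x))"
  shows "(\<lambda>x\<in>topspace X. h (f x) (g x)) \<in> carrier (Cc X)"
proof -
  have "(\<lambda>x. h (f x) (g x)) ` topspace X \<subseteq> (\<lambda>(a, b). h a b) ` (f ` topspace X \<times> g ` topspace X)"
    by auto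
  moreover have "countable \<dots>" using assms(1,2) by (auto simp: Cc_def)
  ultimately have "countable ((\<lambda>x. h (f x) (g x)) ` topspace X)" by (rule countable_subset)
  moreover have "continuous_map X euclidean (\<lambda>x\<in>topspace X. h (f x) (g x))"
    by (rule continuous_map_eq[OF assms(3)]) simp
  ultimately show ?thesis by (simp add: Cc_def)
qed

theorem Cc_cring: "cring (Cc X :: ('a \<Rightarrow> 'f::{linordered_field,linorder_topology}) ring)"
proof (rule cringI)
  let ?R = "Cc X :: ('a \<Rightarrow> 'f) ring"
  have const: "(\<lambda>x\<in>topspace X. c) \<in> carrier ?R" for c
    by (auto simp: Cc_def intro: continuous_map_eq[of X euclidean "\<lambda>_. c"] countable_subset[of _ "{c}"])
  have add: "f \<oplus>\<^bsub>?R\<^esub> g \<in> carrier ?R" and mult: "f \<otimes>\<^bsub>?R\<^esub> g \<in> carrier ?R"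
    if "f \<in> carrier ?R" "g \<in> carrier ?R" for f g
  proof -
    have "continuous_map X euclidean f" "continuous_map X euclidean g"
      using that by (auto simp: Cc_def)
    note c = continuous_map_field[OF this]
    show "f \<oplus>\<^bsub>?R\<^esub> g \<in> carrier ?R" "f \<otimes>\<^bsub>?R\<^esub> g \<in> carrier ?R"
      using Cc_binop_closed[OF that c(1)] Cc_binop_closed[OF that c(2)] by (simp_all add: Cc_def)
  qed
  show "abelian_group ?R"
  proof (rule abelian_groupI)
    fix f assume f: "f \<in> carrier ?R"
    have "(\<lambda>x\<in>topspace X. -1) \<otimes>\<^bsub>?R\<^esub> f \<in> carrier ?R" by (rule mult[OF const f])
    moreover have "((\<lambda>x\<in>topspace X. -1) \<otimes>\<^bsub>?R\<^esub> f) \<oplus>\<^bsub>?R\<^esub> f = \<zero>\<^bsub>?R\<^esub>"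
      by (auto simp: Cc_def restrict_def)
    ultimately show "\<exists>g\<in>carrier ?R. g \<oplus>\<^bsub>?R\<^esub> f = \<zero>\<^bsub>?R\<^esub>" by blast
    show "\<zero>\<^bsub>?R\<^esub> \<oplus>\<^bsub>?R\<^esub> f = f" using f by (auto simp: Cc_def extensional_def restrict_def)
  qed (use add const in \<open>auto simp: Cc_def restrict_def algebra_simps\<close>)
  show "comm_monoid ?R"
    by (rule comm_monoidI)
      (use mult const in \<open>auto simp: Cc_def restrict_def extensional_def algebra_simps\<close>)
  show "(f \<oplus>\<^bsub>?R\<^esub> g) \<otimes>\<^bsub>?R\<^esub> h = f \<otimes>\<^bsub>?R\<^esub> h \<oplus>\<^bsub>?R\<^esub> g \<otimes>\<^bsub>?R\<^esub> h" for f g h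
    by (auto simp: Cc_def restrict_def algebra_simps)
qed

definition Zc :: "'a topology \<Rightarrow> ('a \<Rightarrow> 'f::zero) \<Rightarrow> 'a set" where
  "Zc X f = {x \<in> topspace X. f x = 0}"

definition Mc :: "'a topology \<Rightarrow> 'b topology \<Rightarrow> ('a \<Rightarrow> 'b) \<Rightarrow> 'b \<Rightarrow>
    ('a \<Rightarrow> 'f::{linordered_field,linorder_topology}) set" where
  "Mc X B e p = {f \<in> carrier (Cc X). p \<in> B closure_of (e ` Zc X f)}"

definition Oc :: "'a topology \<Rightarrow> 'b topology \<Rightarrow> ('a \<Rightarrow> 'b) \<Rightarrow> 'b \<Rightarrow>
    ('a \<Rightarrow> 'f::{linordered_field,linorder_topology}) set" where
  "Oc X B e p = {f \<in> carrier (Cc X).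
     \<exists>U. openin B U \<and> p \<in> U \<and> U \<subseteq> B closure_of (e ` Zc X f)}"


section \<open>Ideals\<close>

definition proper_ideal :: "'r set \<Rightarrow> ('r, 'm) ring_scheme \<Rightarrow> bool" where
  "proper_ideal I R \<longleftrightarrow> ideal I R \<and> I \<noteq> carrier R"

definition Z_Fc_ideal ::
    "('a \<Rightarrow> 'f::{linordered_field,linorder_topology}) set \<Rightarrow> 'a topology \<Rightarrow> bool" where
  "Z_Fc_ideal I X \<longleftrightarrow> proper_ideal I (Cc X) \<and>
     (\<forall>f\<in>carrier (Cc X). \<forall>g\<in>I. Zc X f = Zc X g \<longrightarrow> f \<in> I)"

text \<open>
  The intersection is taken inside \<open>topspace X\<close>; this only matters for an empty family, and an
  ideal is never empty.
\<close>

definition fixed_ideal ::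
    "('a \<Rightarrow> 'f::{linordered_field,linorder_topology}) set \<Rightarrow> 'a topology \<Rightarrow> bool" where
  "fixed_ideal I X \<longleftrightarrow> proper_ideal I (Cc X) \<and> topspace X \<inter> (\<Inter>f\<in>I. Zc X f) \<noteq> {}"

definition minimal_primeideal :: "'r set \<Rightarrow> ('r, 'm) ring_scheme \<Rightarrow> bool" where
  "minimal_primeideal P R \<longleftrightarrow> primeideal P R \<and> (\<forall>Q. primeideal Q R \<and> Q \<subseteq> P \<longrightarrow> Q = P)"

text \<open>If no minimal prime ideal contains \<open>a\<close>, the intersection is the whole ring.\<close>

definition minimal_prime_hull :: "('r, 'm) ring_scheme \<Rightarrow> 'r \<Rightarrow> 'r set" where
  "minimal_prime_hull R a = carrier R \<inter> \<Inter>{P. minimal_primeideal P R \<and> a \<in> P}"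

definition zo_ideal :: "'r set \<Rightarrow> ('r, 'm) ring_scheme \<Rightarrow> bool" where
  "zo_ideal I R \<longleftrightarrow> proper_ideal I R \<and> (\<forall>a\<in>I. minimal_prime_hull R a \<subseteq> I)"

definition zero_divisor :: "('r, 'm) ring_scheme \<Rightarrow> 'r \<Rightarrow> bool" where
  "zero_divisor R a \<longleftrightarrow> a \<in> carrier R \<and>
     (\<exists>b\<in>carrier R. b \<noteq> \<zero>\<^bsub>R\<^esub> \<and> a \<otimes>\<^bsub>R\<^esub> b = \<zero>\<^bsub>R\<^esub>)"

end

theory Submission
  imports Defs
begin

text \<open>
  Both \<open>M\<^sup>p\<close> and \<open>O\<^sup>p\<close> are controlled by the clopen sets \<open>D\<close> of the compactification that
  contain \<open>p\<close>: a function lies in \<open>M\<^sup>p\<close> iff it has a zero in the trace on \<open>X\<close> of each such \<open>D\<close>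
  (\<open>Mc_iff\<close>), and it lies in \<open>O\<^sup>p\<close> iff it vanishes on the trace of some such \<open>D\<close> (\<open>Oc_iff\<close>).
  These two descriptions use that \<open>X\<close> is dense, that \<open>B\<close> is zero-dimensional, and that every
  clopen subset of \<open>X\<close> is the trace of a clopen subset of \<open>B\<close>, which is the extension
  property applied to the indicator function of the set. Since indicator functions of clopen
  sets belong to the ring, most of the claims about \<open>O\<^sup>p\<close> reduce to statements about these
  idempotents. For instance, if \<open>f\<close> vanishes on the trace \<open>C\<close> of \<open>D\<close>, then the indicator of \<open>C\<close>
  annihilates \<open>f\<close> and is not in \<open>M\<^sup>p\<close>; and if \<open>q\<close> is not in \<open>D\<close>, then the indicator of
  the complement of \<open>C\<close> is in \<open>O\<^sup>p\<close> but not in \<open>M\<^sup>q\<close> (\<open>Oc_subset_Mc_imp_eq\<close>).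

  For the \<open>z\<^sup>o\<close>-property, let \<open>a\<close> vanish on the clopen set \<open>C\<close> and let \<open>b\<close> lie in every minimal
  prime ideal containing \<open>a\<close>. For \<open>x\<close> in \<open>C\<close>, the functions vanishing at \<open>x\<close> form a prime ideal;
  a minimal prime ideal below it omits the indicator of \<open>C\<close>, hence contains \<open>a\<close>, hence
  contains \<open>b\<close>, so that \<open>b\<close> vanishes at \<open>x\<close> (\<open>minimal_prime_hull_vanishes\<close>).

  The description of the ideals below a unique maximal ideal rests on the fact that the maximal
  ideals are exactly the \<open>M\<^sup>p\<close>. Here the hypothesis
  on the field enters: a countable set of values leaves a gap in the field, and cutting the
  quotient \<open>f\<^sup>2 / g\<^sup>2\<close> at a gap separates disjoint zero sets by a clopen set
  (\<open>disjoint_zero_sets_separated\<close>). Consequently \<open>M\<^sup>p\<close> is closed under addition. Compactness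
  puts each proper ideal into some \<open>M\<^sup>p\<close>, because a nowhere vanishing function is a unit and
  \<open>f\<^sup>2 + g\<^sup>2\<close> vanishes only at the common zeros of \<open>f\<close> and \<open>g\<close>. If \<open>M\<^sup>p\<close> is the only maximal
  ideal above \<open>I\<close> and \<open>f\<close> vanishes on the trace \<open>C\<close> of a clopen \<open>D\<close> around \<open>p\<close>, then
  compactness of the complement of \<open>D\<close> yields a member of \<open>I\<close> whose zeros all lie in \<open>C\<close>; such a
  member divides the indicator of the complement of \<open>C\<close>, which in turn divides \<open>f\<close>.
\<close>


section \<open>Gaps and inverses in ordered fields\<close>

text \<open>
  Every countable set misses a cut at some positive place: each element lies strictly below a
  member of the lower set or strictly above a member of the upper set. The cut is a pair of
  subsets of the field, because in a countable subfield of the reals it has to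
  be made at a real number outside the field.
\<close>

definition countable_sets_have_gaps :: "'f::linordered_field itself \<Rightarrow> bool" where
  "countable_sets_have_gaps _ \<longleftrightarrow>
     (\<forall>S :: 'f set. countable S \<longrightarrow>
        (\<exists>L U. (\<forall>l\<in>L. \<forall>u\<in>U. l \<le> u) \<and> (\<exists>l\<in>L. 0 < l) \<and> U \<noteq> {} \<and>
           (\<forall>s\<in>S. (\<exists>l\<in>L. s < l) \<or> (\<exists>u\<in>U. u < s))))"

lemma countable_sets_have_gaps_uncountable:
  assumes "uncountable (UNIV :: 'f::linordered_field set)"
  shows "countable_sets_have_gaps TYPE('f)"
  unfolding countable_sets_have_gaps_def
proof (intro allI impI)
  fix S :: "'f set" assume S: "countable S"
  have "\<exists>c>0. c \<notin> S"
  proof (rule ccontr)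
    assume "\<not> ?thesis"
    then have pos: "c \<in> S" if "0 < c" for c using that by blast
    have "c \<in> S \<union> uminus ` S \<union> {0}" for c
      using pos[of c] pos[of "- c"] image_eqI[of c uminus "- c" S] by (cases c "0 :: 'f" rule: linorder_cases) auto
    then have "(UNIV :: 'f set) \<subseteq> S \<union> uminus ` S \<union> {0}" by blast
    moreover have "countable (S \<union> uminus ` S \<union> {0})" using S by simp
    ultimately show False using assms countable_subset by blast
  qed
  then obtain c where c: "c > 0" "c \<notin> S" by blast
  show "\<exists>L U. (\<forall>l\<in>L. \<forall>u\<in>U. l \<le> u) \<and> (\<exists>l\<in>L. 0 < l) \<and> U \<noteq> {} \<and>
      (\<forall>s\<in>S. (\<exists>l\<in>L. s < l) \<or> (\<exists>u\<in>U. u < s))"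
    by (rule exI[of _ "{c}"], rule exI[of _ "{c}"]) (use c in \<open>auto, metis linorder_neqE\<close>)
qed

lemma countable_sets_have_gaps_real_subfield:
  assumes "countable (UNIV :: 'f::linordered_field set)" and "real_subfield TYPE('f)"
  shows "countable_sets_have_gaps TYPE('f)"
  unfolding countable_sets_have_gaps_def
proof (intro allI impI)
  fix S :: "'f set"
  \<comment> \<open>The cut is made at a real number \<open>r\<close> outside the countable image of the field; the rationals
    in the image provide field elements on either side, arbitrarily close to \<open>r\<close>.\<close>
  obtain \<phi> :: "'f \<Rightarrow> real" where \<phi>: "\<phi> 1 = 1" "\<And>x y. \<phi> (x + y) = \<phi> x + \<phi> y"
      "\<And>x y. \<phi> (x * y) = \<phi> x * \<phi> y" "strict_mono \<phi>"
    using assms(2) unfolding real_subfield_def by blast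
  have \<phi>0: "\<phi> 0 = 0" using \<phi>(2)[of 0 0] by simp
  have \<phi>m: "\<phi> (- x) = - \<phi> x" for x using \<phi>(2)[of x "- x"] \<phi>0 by simp
  have \<phi>n: "\<phi> (of_nat n) = of_nat n" for n by (induction n) (simp_all add: \<phi>0 \<phi>)
  have \<phi>i: "\<phi> (of_int k) = of_int k" for k by (cases k) (simp_all add: \<phi>n \<phi>m \<phi> del: of_nat_Suc)
  have \<phi>q: "\<phi> (of_rat q) = of_rat q" for q
  proof (cases q)
    case (Fract a b)
    then have ab: "(of_rat q :: 'f) * of_int b = of_int a" "(of_rat q :: real) * of_int b = of_int a"
      by (simp_all add: of_rat_rat)
    have "\<phi> (of_rat q) * of_int b = \<phi> (of_rat q * of_int b)" by (simp only: \<phi>(3) \<phi>i)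
    also have "\<dots> = of_rat q * of_int b" by (simp only: ab \<phi>i)
    finally show ?thesis using Fract by simp
  qed
  have lt: "\<phi> x < \<phi> y \<longleftrightarrow> x < y" for x y using \<phi>(4) by (rule strict_mono_less)
  have "countable (range \<phi>)" using assms(1) by blast
  moreover have "uncountable {0<..<1::real}" by (simp add: uncountable_open_interval)
  ultimately have "\<not> {0<..<1} \<subseteq> range \<phi>" using countable_subset by blast
  then obtain r where "r \<in> {0<..<1}" and r_new: "r \<notin> range \<phi>" by blast
  then have r: "0 < r" "r < 1" by simp_all
  have between: "\<exists>q. x < \<phi> q \<and> \<phi> q < y" if "x < y" for x y
    using of_rat_dense[OF that] \<phi>q by metis
  have "\<exists>l. 0 < l \<and> \<phi> l < r"
    using between[OF r(1)] lt[of 0] \<phi>0 by auto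
  moreover have "r < \<phi> 1" using r \<phi>(1) by simp
  moreover have "(\<exists>l. \<phi> l < r \<and> s < l) \<or> (\<exists>u. r < \<phi> u \<and> u < s)" for s
  proof -
    have "\<phi> s \<noteq> r" using r_new by blast
    then have "\<phi> s < r \<or> r < \<phi> s" by linarith
    then show ?thesis using between[of "\<phi> s" r] between[of r "\<phi> s"] lt by blast
  qed
  moreover have "l \<le> u" if "\<phi> l < r" "r < \<phi> u" for l u using less_trans[OF that] lt by (simp add: less_imp_le)
  ultimately show "\<exists>L U. (\<forall>l\<in>L. \<forall>u\<in>U. l \<le> u) \<and> (\<exists>l\<in>L. 0 < l) \<and> U \<noteq> {} \<and>
      (\<forall>s\<in>S. (\<exists>l\<in>L. s < l) \<or> (\<exists>u\<in>U. u < s))"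
    by (intro exI[of _ "{l. \<phi> l < r}"] exI[of _ "{u. r < \<phi> u}"]) auto
qed

lemma tendsto_inverse_field:
  fixes f :: "'a \<Rightarrow> 'f::{linordered_field,linorder_topology}"
  assumes "(f \<longlongrightarrow> l) F" "l \<noteq> 0"
  shows "((\<lambda>x. inverse (f x)) \<longlongrightarrow> inverse l) F"
  unfolding tendsto_abs_iff
proof (intro allI impI)
  fix r :: 'f assume r: "r > 0"
  define a where "a = \<bar>l\<bar>"
  have a: "a > 0" using assms(2) by (simp add: a_def)
  then have "0 < a / 2" "0 < r * (a * a) / 2" using r by simp_all
  then have "\<forall>\<^sub>F x in F. \<bar>f x - l\<bar> < a / 2" "\<forall>\<^sub>F x in F. \<bar>f x - l\<bar> < r * (a * a) / 2"
    using assms(1) unfolding tendsto_abs_iff by blast+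
  then show "\<forall>\<^sub>F x in F. \<bar>inverse (f x) - inverse l\<bar> < r"
  proof eventually_elim
    case (elim x)
    have fx: "a / 2 < \<bar>f x\<bar>"
      using elim(1) abs_triangle_ineq2[of l "f x"] by (simp add: a_def abs_minus_commute)
    then have nz: "f x \<noteq> 0" using a by auto
    have "inverse (f x) - inverse l = (l - f x) / (f x * l)"
      using nz assms(2) by (simp add: field_simps)
    then have "\<bar>inverse (f x) - inverse l\<bar> = \<bar>f x - l\<bar> / (\<bar>f x\<bar> * a)"
      by (simp add: abs_mult a_def abs_minus_commute)
    also have "\<dots> < r"
    proof -
      have "r * (a * a) / 2 = r * ((a / 2) * a)" by simp
      also have "\<dots> < r * (\<bar>f x\<bar> * a)" using fx a r by (intro mult_strict_left_mono mult_strict_right_mono)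
      finally have "\<bar>f x - l\<bar> < r * (\<bar>f x\<bar> * a)" using elim(2) by simp
      then show ?thesis using nz a by (simp add: pos_divide_less_eq)
    qed
    finally show ?case .
  qed
qed


section \<open>Clopen sets and functions with countable range\<close>

lemma Cc_carrier_iff:
  "f \<in> carrier (Cc X) \<longleftrightarrow>
     f \<in> extensional (topspace X) \<and> continuous_map X euclidean f \<and> countable (f ` topspace X)"
  by (simp add: Cc_def)

lemma Cc_apply:
  assumes "x \<in> topspace X"
  shows "(f \<otimes>\<^bsub>Cc X\<^esub> g) x = f x * g x" "(f \<oplus>\<^bsub>Cc X\<^esub> g) x = f x + g x"
    "\<one>\<^bsub>Cc X\<^esub> x = 1" "\<zero>\<^bsub>Cc X\<^esub> x = 0"
  using assms by (simp_all add: Cc_def)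

lemma Cc_eqI:
  assumes "f \<in> carrier (Cc X)" "g \<in> carrier (Cc X)" "\<And>x. x \<in> topspace X \<Longrightarrow> f x = g x"
  shows "f = g"
  using assms by (auto simp: Cc_carrier_iff intro: extensionalityI)

lemma Cc_closed:
  "f \<in> carrier (Cc X) \<Longrightarrow> g \<in> carrier (Cc X) \<Longrightarrow> f \<otimes>\<^bsub>Cc X\<^esub> g \<in> carrier (Cc X)"
  "f \<in> carrier (Cc X) \<Longrightarrow> g \<in> carrier (Cc X) \<Longrightarrow> f \<oplus>\<^bsub>Cc X\<^esub> g \<in> carrier (Cc X)"
  "\<one>\<^bsub>Cc X\<^esub> \<in> carrier (Cc X)" "\<zero>\<^bsub>Cc X\<^esub> \<in> carrier (Cc X)"
proof -
  interpret cring "Cc X" by (rule Cc_cring)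
  show "f \<in> carrier (Cc X) \<Longrightarrow> g \<in> carrier (Cc X) \<Longrightarrow> f \<otimes>\<^bsub>Cc X\<^esub> g \<in> carrier (Cc X)"
    "f \<in> carrier (Cc X) \<Longrightarrow> g \<in> carrier (Cc X) \<Longrightarrow> f \<oplus>\<^bsub>Cc X\<^esub> g \<in> carrier (Cc X)"
    "\<one>\<^bsub>Cc X\<^esub> \<in> carrier (Cc X)" "\<zero>\<^bsub>Cc X\<^esub> \<in> carrier (Cc X)" by simp_all
qed

lemma Cc_glue:
  assumes f: "f \<in> carrier (Cc X)" and g: "g \<in> carrier (Cc X)" and C: "openin X C" "closedin X C"
  shows "(\<lambda>x\<in>topspace X. if x \<in> C then f x else g x) \<in> carrier (Cc X)"
proof -
  let ?h = "\<lambda>x\<in>topspace X. if x \<in> C then f x else g x"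
  have "openin X {x \<in> topspace X. ?h x \<in> U}" if "open U" for U
  proof -
    have "{x \<in> topspace X. ?h x \<in> U} =
        (C \<inter> {x \<in> topspace X. f x \<in> U}) \<union> ((topspace X - C) \<inter> {x \<in> topspace X. g x \<in> U})"
      using openin_subset[OF C(1)] by auto
    moreover have "openin X {x \<in> topspace X. f x \<in> U}" "openin X {x \<in> topspace X. g x \<in> U}"
      using f g that by (auto simp: Cc_carrier_iff intro!: openin_continuous_map_preimage)
    ultimately show ?thesis using C by (simp add: openin_Un openin_Int openin_diff)
  qed
  then have "continuous_map X euclidean ?h" by (simp add: continuous_map_def)
  moreover have "countable (?h ` topspace X)"
    by (rule countable_subset[of _ "f ` topspace X \<union> g ` topspace X"])
      (use f g in \<open>auto simp: Cc_carrier_iff\<close>)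
  ultimately show ?thesis by (simp add: Cc_carrier_iff)
qed

definition clopen_ind :: "'a topology \<Rightarrow> 'a set \<Rightarrow> 'a \<Rightarrow> 'f::{linordered_field,linorder_topology}" where
  "clopen_ind X C = (\<lambda>x\<in>topspace X. if x \<in> C then 1 else 0)"

lemma clopen_ind_apply [simp]: "x \<in> topspace X \<Longrightarrow> clopen_ind X C x = (if x \<in> C then 1 else 0)"
  by (simp add: clopen_ind_def)

lemma clopen_ind_in_Cc:
  fixes X :: "'a topology"
  assumes "openin X C" "closedin X C"
  shows "clopen_ind X C \<in> carrier (Cc X :: ('a \<Rightarrow> 'f::{linordered_field,linorder_topology}) ring)"
proof -
  have "(clopen_ind X C :: 'a \<Rightarrow> 'f) = (\<lambda>x\<in>topspace X. if x \<in> C then \<one>\<^bsub>Cc X\<^esub> x else \<zero>\<^bsub>Cc X\<^esub> x)"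
    by (auto simp: clopen_ind_def Cc_def)
  then show ?thesis using Cc_glue[OF Cc_closed(3) Cc_closed(4) assms] by simp
qed

lemma clopen_diff:
  assumes "openin X C" "closedin X C"
  shows "openin X (topspace X - C)" "closedin X (topspace X - C)"
  using assms by auto

lemma Cc_inverse:
  assumes f: "f \<in> carrier (Cc X)" and nz: "\<And>x. x \<in> topspace X \<Longrightarrow> f x \<noteq> 0"
  shows "(\<lambda>x\<in>topspace X. inverse (f x)) \<in> carrier (Cc X)"
proof -
  have "continuous_map X euclidean (\<lambda>x. inverse (f x))"
    using f nz by (auto simp: Cc_carrier_iff continuous_map_atin intro!: tendsto_inverse_field)
  then have "continuous_map X euclidean (\<lambda>x\<in>topspace X. inverse (f x))"
    by (rule continuous_map_eq) simp
  moreover have "(\<lambda>x\<in>topspace X. inverse (f x)) ` topspace X = inverse ` (f ` topspace X)" by auto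
  ultimately show ?thesis using f by (simp add: Cc_carrier_iff)
qed

text \<open>
  Extending \<open>f\<close> by the value \<open>1\<close> outside \<open>C\<close> gives a nowhere vanishing, hence invertible,
  function. For \<open>C = topspace X\<close> this says that a function without zeros is a unit.
\<close>

lemma clopen_ind_multiple:
  assumes f: "f \<in> carrier (Cc X)" and C: "openin X C" "closedin X C"
    and nz: "\<And>x. x \<in> C \<Longrightarrow> f x \<noteq> 0"
  shows "\<exists>h\<in>carrier (Cc X). h \<otimes>\<^bsub>Cc X\<^esub> f = clopen_ind X C"
proof -
  let ?g = "\<lambda>x\<in>topspace X. if x \<in> C then f x else \<one>\<^bsub>Cc X\<^esub> x"
  let ?h = "clopen_ind X C \<otimes>\<^bsub>Cc X\<^esub> (\<lambda>x\<in>topspace X. inverse (?g x))"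
  have "(\<lambda>x\<in>topspace X. inverse (?g x)) \<in> carrier (Cc X)"
    by (rule Cc_inverse[OF Cc_glue[OF f Cc_closed(3) C]]) (auto simp: nz Cc_apply)
  then have h: "?h \<in> carrier (Cc X)" by (intro Cc_closed(1) clopen_ind_in_Cc C)
  have "?h \<otimes>\<^bsub>Cc X\<^esub> f = clopen_ind X C"
    by (rule Cc_eqI[OF Cc_closed(1)[OF h f] clopen_ind_in_Cc[OF C]])
      (auto simp: Cc_apply nz)
  with h show ?thesis by blast
qed

text \<open>
  The quotient \<open>f\<^sup>2 / g\<^sup>2\<close> takes countably many values, so a positive cut avoids them all. The
  points of \<open>C\<close> below the cut and those above it are then complementary open sets, and the
  former contain the zeros of \<open>f\<close> while the latter contain those of \<open>g\<close>. Clearing denominators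
  in \<open>f\<^sup>2 / g\<^sup>2 < l\<close> gives a condition that is open also at the zeros of \<open>g\<close>.
\<close>

lemma disjoint_zero_sets_separated:
  fixes f g :: "'a \<Rightarrow> 'f::{linordered_field,linorder_topology}"
  assumes F: "countable_sets_have_gaps TYPE('f)"
    and f: "f \<in> carrier (Cc X)" and g: "g \<in> carrier (Cc X)"
    and C: "openin X C" "closedin X C"
    and disj: "\<And>x. x \<in> C \<Longrightarrow> f x \<noteq> 0 \<or> g x \<noteq> 0"
  shows "\<exists>E. openin X E \<and> closedin X E \<and> C \<inter> Zc X f \<subseteq> E \<and> C \<inter> E \<inter> Zc X g = {}"
proof -
  let ?q = "\<lambda>x. (f x * f x) / (g x * g x)"
  have "?q ` topspace X \<subseteq> (\<lambda>(a, b). (a * a) / (b * b)) ` (f ` topspace X \<times> g ` topspace X)"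
    by auto
  moreover have "countable \<dots>" using f g by (simp add: Cc_carrier_iff)
  ultimately have "countable (?q ` topspace X)" by (rule countable_subset)
  then obtain L U where LU: "\<forall>l\<in>L. \<forall>u\<in>U. l \<le> u" "\<exists>l\<in>L. 0 < l" "U \<noteq> {}"
      and cut': "\<forall>s\<in>?q ` topspace X. (\<exists>l\<in>L. s < l) \<or> (\<exists>u\<in>U. u < s)"
    using F[unfolded countable_sets_have_gaps_def, rule_format, of "?q ` topspace X"] by blast
  have cut: "(\<exists>l\<in>L. ?q x < l) \<or> (\<exists>u\<in>U. u < ?q x)" if "x \<in> topspace X" for x
    using cut' that by (rule bspec[OF _ imageI])
  define A where "A l = {x \<in> topspace X. f x * f x < l * (g x * g x)}" for l
  define D where "D u = {x \<in> topspace X. u * (g x * g x) < f x * f x}" for u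
  have cont: "continuous_map X euclidean (\<lambda>x. l * (g x * g x) + (- 1) * (f x * f x))" for l
    by (intro continuous_map_field continuous_map_const[THEN iffD2])
      (use f g in \<open>auto simp: Cc_carrier_iff\<close>)
  have "openin X (A l)" for l
    using openin_continuous_map_preimage[OF cont[of l], of "{0<..}"] by (simp add: A_def)
  moreover have "openin X (D u)" for u
    using openin_continuous_map_preimage[OF cont[of u], of "{..<0}"] by (simp add: D_def)
  ultimately have op: "openin X (C \<inter> (\<Union>l\<in>L. A l))" "openin X (C \<inter> (\<Union>u\<in>U. D u))"
    using C by (auto intro!: openin_Int)
  have sub: "C \<subseteq> topspace X" using C openin_subset by blast
  have sq_pos: "0 < a * a" if "a \<noteq> 0" for a :: 'f
    using that by (auto simp: zero_less_mult_iff neq_iff)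
  have cover: "x \<in> (\<Union>l\<in>L. A l) \<or> x \<in> (\<Union>u\<in>U. D u)" if "x \<in> C" for x
  proof (cases "g x = 0")
    case True
    then have "0 < f x * f x" using disj[OF that] sq_pos by blast
    then show ?thesis using True LU(3) that sub by (auto simp: D_def)
  next
    case False
    then have "0 < g x * g x" by (rule sq_pos)
    then show ?thesis using cut[of x] that sub
      by (auto simp: A_def D_def pos_divide_less_eq pos_less_divide_eq)
  qed
  have ndisj: "\<not> (x \<in> A l \<and> x \<in> D u)" if "l \<in> L" "u \<in> U" for x l u
  proof
    assume "x \<in> A l \<and> x \<in> D u"
    then have "u * (g x * g x) < l * (g x * g x)" unfolding A_def D_def by simp
    moreover have "l * (g x * g x) \<le> u * (g x * g x)" using LU(1) that by (simp add: mult_right_mono)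
    ultimately show False by simp
  qed
  let ?E = "C \<inter> (\<Union>l\<in>L. A l)"
  have "?E = C - (C \<inter> (\<Union>u\<in>U. D u))" using cover ndisj by blast
  then have "closedin X ?E" using C op(2) by (metis closedin_diff)
  moreover have "C \<inter> Zc X f \<subseteq> ?E"
  proof
    fix x assume x: "x \<in> C \<inter> Zc X f"
    then have "0 < g x * g x" using disj[of x] by (intro sq_pos) (auto simp: Zc_def)
    then show "x \<in> ?E" using x LU(2) sub by (auto simp: A_def Zc_def zero_less_mult_iff intro: bexI)
  qed
  moreover have "C \<inter> ?E \<inter> Zc X g = {}"
    by (auto simp: A_def Zc_def mult_less_0_iff not_less)
  ultimately show ?thesis using op(1) by blast
qed


section \<open>Prime ideals of a commutative ring\<close>

lemma (in cring) ideal_from_closure: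
  assumes "I \<subseteq> carrier R" "\<zero> \<in> I" "\<And>a b. a \<in> I \<Longrightarrow> b \<in> I \<Longrightarrow> a \<oplus> b \<in> I"
    and mult: "\<And>a x. a \<in> I \<Longrightarrow> x \<in> carrier R \<Longrightarrow> x \<otimes> a \<in> I"
  shows "ideal I R"
proof (rule idealI[OF ring_axioms])
  have "\<ominus> a \<in> I" if "a \<in> I" for a
    using mult[OF that, of "\<ominus> \<one>"] that assms(1) by (simp add: l_minus subset_iff)
  then show "subgroup I (add_monoid R)"
    using assms by (intro add.subgroupI) (auto simp: a_inv_def)
  show "x \<otimes> a \<in> I" "a \<otimes> x \<in> I" if "a \<in> I" "x \<in> carrier R" for a x
    using mult[OF that] that assms(1) m_comm[of a x] by auto
qed

text \<open>
  Zorn's lemma, in the form for unions of increasing chains, is applied to the complements of the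
  prime ideals inside \<open>P\<close>; the intersection of a chain of prime ideals is prime.
\<close>

lemma (in cring) minimal_prime_below:
  assumes P: "primeideal P R"
  shows "\<exists>Q. minimal_primeideal Q R \<and> Q \<subseteq> P"
proof -
  define \<A> where "\<A> = uminus ` {Q. primeideal Q R \<and> Q \<subseteq> P}"
  have in_\<A>: "Y \<in> \<A> \<longleftrightarrow> primeideal (- Y) R \<and> - Y \<subseteq> P" for Y
    unfolding \<A>_def by (metis (mono_tags, lifting) double_complement image_iff mem_Collect_eq)
  have "\<exists>M\<in>\<A>. \<forall>Y\<in>\<A>. M \<subseteq> Y \<longrightarrow> Y = M"
  proof (rule subset_Zorn_nonempty)
    show "\<A> \<noteq> {}" using P by (auto simp: \<A>_def)
    fix \<C> assume ne: "\<C> \<noteq> {}" and chain: "subset.chain \<A> \<C>"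
    define S where "S = uminus ` \<C>"
    have S: "primeideal Q R" "Q \<subseteq> P" if "Q \<in> S" for Q
      using that chain by (auto simp: S_def in_\<A> subset_chain_def subset_iff)
    have comparable: "Q \<subseteq> Q' \<or> Q' \<subseteq> Q" if "Q \<in> S" "Q' \<in> S" for Q Q'
      using that chain by (auto simp: S_def subset_chain_def)
    have neS: "S \<noteq> {}" using ne by (simp add: S_def)
    have "primeideal (\<Inter>S) R"
    proof (rule primeidealI[OF _ is_cring])
      show "ideal (\<Inter>S) R"
        using S(1) neS by (intro i_Intersect) (auto simp: primeideal_def)
      obtain Q where Q: "Q \<in> S" using neS by blast
      then interpret Q: primeideal Q R using S(1) by blast
      have "\<one> \<notin> Q" using Q.I_notcarr Q.one_imp_carrier by blast
      then show "carrier R \<noteq> \<Inter>S" using Q one_closed by blast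
      fix a b assume ab: "a \<in> carrier R" "b \<in> carrier R" "a \<otimes> b \<in> \<Inter>S"
      show "a \<in> \<Inter>S \<or> b \<in> \<Inter>S"
      proof (rule ccontr)
        assume "\<not> ?thesis"
        then obtain Q\<^sub>1 Q\<^sub>2 where "Q\<^sub>1 \<in> S" "Q\<^sub>2 \<in> S" "a \<notin> Q\<^sub>1" "b \<notin> Q\<^sub>2" by blast
        then obtain Q' where "Q' \<in> S" "a \<notin> Q'" "b \<notin> Q'" using comparable by blast
        then show False using ab primeideal.I_prime[OF S(1)] by blast
      qed
    qed
    moreover have "\<Inter>S \<subseteq> P" using S(2) neS by blast
    moreover have "\<Union>\<C> = - \<Inter>S" by (auto simp: S_def)
    ultimately show "\<Union>\<C> \<in> \<A>" by (simp add: in_\<A>)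
  qed
  then obtain M where M: "M \<in> \<A>" and max: "\<And>Y. Y \<in> \<A> \<Longrightarrow> M \<subseteq> Y \<Longrightarrow> Y = M" by blast
  define Q where "Q = - M"
  have Q: "primeideal Q R" "Q \<subseteq> P" using M by (simp_all add: Q_def in_\<A>)
  have "minimal_primeideal Q R"
    unfolding minimal_primeideal_def
  proof (intro conjI allI impI Q(1))
    fix Y assume "primeideal Y R \<and> Y \<subseteq> Q"
    then have "- Y = M" using Q(2) by (intro max) (auto simp: Q_def in_\<A>)
    then show "Y = Q" by (auto simp: Q_def)
  qed
  with Q(2) show ?thesis by blast
qed

lemma Cc_point_ideal_prime:
  assumes x: "x \<in> topspace X"
  shows "primeideal {f \<in> carrier (Cc X). f x = 0} (Cc X)"
proof -
  interpret cring "Cc X" by (rule Cc_cring)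
  show ?thesis
  proof (rule primeidealI[OF _ Cc_cring])
    show "ideal {f \<in> carrier (Cc X). f x = 0} (Cc X)"
      by (rule ideal_from_closure) (auto simp: Cc_apply[OF x])
    have "\<one>\<^bsub>Cc X\<^esub> \<notin> {f \<in> carrier (Cc X). f x = 0}" by (simp add: Cc_apply[OF x])
    then show "carrier (Cc X) \<noteq> {f \<in> carrier (Cc X). f x = 0}" using one_closed by blast
  qed (auto simp: Cc_apply[OF x])
qed

text \<open>
  The indicator of \<open>C\<close> annihilates \<open>a\<close> and does not vanish at \<open>x\<close>. A minimal prime ideal
  consisting of functions that vanish at \<open>x\<close> therefore contains \<open>a\<close>, and with it \<open>b\<close>.
\<close>

lemma minimal_prime_hull_vanishes:
  fixes a b :: "'a \<Rightarrow> 'f::{linordered_field,linorder_topology}"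
  assumes a: "a \<in> carrier (Cc X)" and b: "b \<in> minimal_prime_hull (Cc X) a"
    and C: "openin X C" "closedin X C" and aC: "\<And>x. x \<in> C \<Longrightarrow> a x = 0" and x: "x \<in> C"
  shows "b x = 0"
proof (rule ccontr)
  assume bx: "b x \<noteq> 0"
  have xX: "x \<in> topspace X" using x C openin_subset by blast
  interpret cring "Cc X :: ('a \<Rightarrow> 'f) ring" by (rule Cc_cring)
  obtain Q :: "('a \<Rightarrow> 'f) set" where Q: "minimal_primeideal Q (Cc X)" "Q \<subseteq> {f \<in> carrier (Cc X). f x = 0}"
    using minimal_prime_below[OF Cc_point_ideal_prime[OF xX]] by blast
  then interpret Q: primeideal Q "Cc X" by (simp add: minimal_primeideal_def)
  have ind: "(clopen_ind X C :: 'a \<Rightarrow> 'f) \<in> carrier (Cc X)" by (rule clopen_ind_in_Cc[OF C])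
  have "a \<otimes>\<^bsub>Cc X\<^esub> clopen_ind X C = \<zero>\<^bsub>Cc X\<^esub>"
    by (rule Cc_eqI) (use a ind aC in \<open>auto simp: Cc_apply\<close>)
  then have "a \<in> Q \<or> clopen_ind X C \<in> Q" using Q.I_prime[OF a ind] Q.zero_closed by simp
  moreover have "clopen_ind X C \<notin> Q" using Q(2) x xX by auto
  ultimately have "a \<in> Q" by blast
  then have "b \<in> Q" using b Q(1) by (auto simp: minimal_prime_hull_def)
  then show False using Q(2) bx by blast
qed


section \<open>The ideals attached to points of the compactification\<close>

text \<open>
  The extension property of the Banaschewski compactification is replaced by its consequence
  for maps into a two-point space: clopen subsets of \<open>X\<close> are traces of clopen subsets of \<open>B\<close>.
\<close>

locale zero_dim_compactification =
  fixes X :: "'a topology" and B :: "'b topology" and e :: "'a \<Rightarrow> 'b"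
  assumes X_zero_dim: "zero_dimensional_space X"
    and B_compact: "compact_space B" and B_Hausdorff: "Hausdorff_space B"
    and B_zero_dim: "zero_dimensional_space B"
    and e_continuous: "continuous_map X B e" and e_inj: "inj_on e (topspace X)"
    and e_dense: "B closure_of (e ` topspace X) = topspace B"
    and clopen_extends: "\<And>C. openin X C \<Longrightarrow> closedin X C \<Longrightarrow>
        \<exists>D. openin B D \<and> closedin B D \<and> (\<forall>x\<in>topspace X. e x \<in> D \<longleftrightarrow> x \<in> C)"
begin

definition trace :: "'b set \<Rightarrow> 'a set" where
  "trace D = {x \<in> topspace X. e x \<in> D}"

lemma e_in: "x \<in> topspace X \<Longrightarrow> e x \<in> topspace B"
  using e_continuous by (auto simp: continuous_map_def)

lemma trace_open: "openin B D \<Longrightarrow> openin X (trace D)"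
  and trace_closed: "closedin B D \<Longrightarrow> closedin X (trace D)"
  unfolding trace_def
  by (rule openin_continuous_map_preimage[OF e_continuous], assumption)
    (rule closedin_continuous_map_preimage[OF e_continuous], assumption)

lemma trace_nonempty:
  assumes "openin B U" "p \<in> U"
  shows "\<exists>x\<in>topspace X. e x \<in> U"
proof -
  have "p \<in> B closure_of (e ` topspace X)" using e_dense assms openin_subset by blast
  then show ?thesis using assms by (auto simp: in_closure_of)
qed

lemma clopen_basis:
  assumes "openin B U" "p \<in> U"
  shows "\<exists>D. openin B D \<and> closedin B D \<and> p \<in> D \<and> D \<subseteq> U"
  using assms B_zero_dim unfolding zero_dimensional_space_alt by blast

lemma separate_points:
  assumes "p \<in> topspace B" "q \<in> topspace B" "p \<noteq> q"
  shows "\<exists>D. openin B D \<and> closedin B D \<and> p \<in> D \<and> q \<notin> D"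
proof -
  obtain U where "openin B U" "p \<in> U" "q \<notin> U"
    using B_Hausdorff assms unfolding Hausdorff_space_def disjnt_def by blast
  then show ?thesis using clopen_basis by blast
qed

lemma closure_of_image_iff:
  assumes "p \<in> topspace B" "S \<subseteq> topspace X"
  shows "p \<in> B closure_of (e ` S) \<longleftrightarrow>
     (\<forall>D. openin B D \<and> closedin B D \<and> p \<in> D \<longrightarrow> (\<exists>x\<in>S. e x \<in> D))"
proof -
  have "\<exists>x\<in>S. e x \<in> U"
    if *: "\<forall>D. openin B D \<and> closedin B D \<and> p \<in> D \<longrightarrow> (\<exists>x\<in>S. e x \<in> D)" and "openin B U" "p \<in> U" for U
    using clopen_basis[OF that(2,3)] * by blast
  then show ?thesis using assms(1) unfolding in_closure_of by blast
qed

lemma Mc_iff: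
  assumes "p \<in> topspace B"
  shows "f \<in> Mc X B e p \<longleftrightarrow> f \<in> carrier (Cc X) \<and>
     (\<forall>D. openin B D \<and> closedin B D \<and> p \<in> D \<longrightarrow> (\<exists>x\<in>topspace X. e x \<in> D \<and> f x = 0))"
  using closure_of_image_iff[OF assms, of "Zc X f"] by (auto simp: Mc_def Zc_def)

text \<open>
  A point of \<open>X\<close> where \<open>f\<close> does not vanish has a clopen neighbourhood free of zeros of \<open>f\<close>, and a
  clopen extension of this neighbourhood to \<open>B\<close> still misses all of them.
\<close>

lemma vanishes_if_in_closure:
  assumes f: "f \<in> carrier (Cc X)" and x: "x \<in> topspace X" and cl: "e x \<in> B closure_of (e ` Zc X f)"
  shows "f x = 0"
proof (rule ccontr)
  assume nz: "f x \<noteq> 0"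
  have "openin X {y \<in> topspace X. f y \<in> - {0}}"
    using f by (intro openin_continuous_map_preimage[of X euclidean]) (auto simp: Cc_carrier_iff)
  then obtain C where C: "openin X C" "closedin X C" "x \<in> C" "C \<subseteq> {y \<in> topspace X. f y \<in> - {0}}"
    using X_zero_dim x nz unfolding zero_dimensional_space_alt
    by (metis (mono_tags, lifting) ComplI mem_Collect_eq singletonD)
  then obtain D where D: "openin B D" "closedin B D" "\<forall>x\<in>topspace X. e x \<in> D \<longleftrightarrow> x \<in> C"
    using clopen_extends by blast
  then obtain y where "y \<in> Zc X f" "e y \<in> D"
    using cl x C(3) unfolding in_closure_of by blast
  then show False using D C(4) by (auto simp: Zc_def)
qed

text \<open>
  If \<open>f\<close> vanishes on the trace of an open set \<open>V\<close>, then by density \<open>V\<close> lies in the closure of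
  the zero set; conversely, a point of \<open>X\<close> in that closure is itself a zero of \<open>f\<close>.
\<close>

lemma Oc_eq_open:
  "(Oc X B e p :: ('a \<Rightarrow> 'f::{linordered_field,linorder_topology}) set) =
     {f \<in> carrier (Cc X). \<exists>V. openin B V \<and> p \<in> V \<and> (\<forall>x\<in>trace V. f x = 0)}"
proof -
  have "V \<subseteq> B closure_of (e ` Zc X f)" if V: "openin B V" and z: "\<forall>x\<in>trace V. f x = 0"
    for V and f :: "'a \<Rightarrow> 'f::{linordered_field,linorder_topology}"
  proof
    fix b assume b: "b \<in> V"
    have "\<exists>x\<in>Zc X f. e x \<in> T" if "openin B T" "b \<in> T" for T
      using trace_nonempty[of "V \<inter> T" b] b that V z by (auto simp: trace_def Zc_def)
    then show "b \<in> B closure_of (e ` Zc X f)"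
      using b V openin_subset by (fastforce simp: in_closure_of)
  qed
  moreover have "\<forall>x\<in>trace U. f x = 0"
    if "f \<in> carrier (Cc X)" "U \<subseteq> B closure_of (e ` Zc X f)"
    for U and f :: "'a \<Rightarrow> 'f::{linordered_field,linorder_topology}"
    using vanishes_if_in_closure that by (auto simp: trace_def)
  ultimately have eq: "(openin B V \<and> p \<in> V \<and> V \<subseteq> B closure_of (e ` Zc X f)) \<longleftrightarrow>
      (openin B V \<and> p \<in> V \<and> (\<forall>x\<in>trace V. f x = 0))"
    if "f \<in> carrier (Cc X)" for V and f :: "'a \<Rightarrow> 'f::{linordered_field,linorder_topology}"
    using that by meson
  show ?thesis
    unfolding Oc_def by (rule Collect_cong, rule conj_cong[OF refl], rule ex_cong1, rule eq)
qed

lemma Oc_iff: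
  "f \<in> Oc X B e p \<longleftrightarrow> f \<in> carrier (Cc X) \<and>
     (\<exists>D. openin B D \<and> closedin B D \<and> p \<in> D \<and> (\<forall>x\<in>trace D. f x = 0))"
proof -
  have "\<exists>D. openin B D \<and> closedin B D \<and> p \<in> D \<and> (\<forall>x\<in>trace D. f x = 0)"
    if "openin B V" "p \<in> V" "\<forall>x\<in>trace V. f x = 0" for V
    using clopen_basis[OF that(1,2)] that(3) by (auto simp: trace_def)
  then show ?thesis unfolding Oc_eq_open by blast
qed

lemma Oc_subset_Mc: "p \<in> topspace B \<Longrightarrow> Oc X B e p \<subseteq> Mc X B e p"
proof
  fix f assume p: "p \<in> topspace B" and "f \<in> Oc X B e p"
  then obtain D where f: "f \<in> carrier (Cc X)" and D: "openin B D" "p \<in> D" "\<forall>x\<in>trace D. f x = 0"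
    unfolding Oc_iff by blast
  have "\<exists>x\<in>topspace X. e x \<in> E \<and> f x = 0" if "openin B E" "p \<in> E" for E
    using trace_nonempty[of "D \<inter> E" p] that D by (auto simp: trace_def)
  then show "f \<in> Mc X B e p" using f p by (simp add: Mc_iff)
qed

lemma one_notin_Mc: "\<one>\<^bsub>Cc X\<^esub> \<notin> Mc X B e p"
  by (auto simp: Mc_def Zc_def Cc_apply cong: conj_cong)

lemma Oc_ideal:
  assumes "p \<in> topspace B"
  shows "ideal (Oc X B e p :: ('a \<Rightarrow> 'f::{linordered_field,linorder_topology}) set) (Cc X)"
proof -
  interpret cring "Cc X :: ('a \<Rightarrow> 'f) ring" by (rule Cc_cring)
  show ?thesis
  proof (rule ideal_from_closure)
    show "Oc X B e p \<subseteq> carrier (Cc X)" by (auto simp: Oc_iff)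
    show "\<zero>\<^bsub>Cc X\<^esub> \<in> Oc X B e p"
      unfolding Oc_iff using assms
      by (auto simp: trace_def Cc_apply Cc_closed intro!: exI[of _ "topspace B"])
    show "x \<otimes>\<^bsub>Cc X\<^esub> a \<in> Oc X B e p" if "a \<in> Oc X B e p" "x \<in> carrier (Cc X)" for a x :: "'a \<Rightarrow> 'f"
      using that unfolding Oc_iff by (auto simp: trace_def Cc_apply)
    fix a b :: "'a \<Rightarrow> 'f" assume "a \<in> Oc X B e p" "b \<in> Oc X B e p"
    then obtain D E where ab: "a \<in> carrier (Cc X)" "b \<in> carrier (Cc X)"
      and D: "openin B D" "closedin B D" "p \<in> D" "\<forall>x\<in>trace D. a x = 0"
      and E: "openin B E" "closedin B E" "p \<in> E" "\<forall>x\<in>trace E. b x = 0"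
      unfolding Oc_iff by blast
    then have "\<forall>x\<in>trace (D \<inter> E). (a \<oplus>\<^bsub>Cc X\<^esub> b) x = 0" by (auto simp: trace_def Cc_apply)
    then show "a \<oplus>\<^bsub>Cc X\<^esub> b \<in> Oc X B e p"
      unfolding Oc_iff using ab D E by (intro conjI exI[of _ "D \<inter> E"]) auto
  qed
qed

lemma Oc_proper: "p \<in> topspace B \<Longrightarrow> proper_ideal (Oc X B e p) (Cc X)"
  unfolding proper_ideal_def using Oc_ideal Oc_subset_Mc one_notin_Mc Cc_closed(3) by blast

text \<open>
  Only closure under addition is not immediate. If \<open>f + g\<close> has no zero in the trace of a clopen
  set \<open>D\<close> around \<open>p\<close>, then \<open>f\<close> and \<open>g\<close> have no common zero there, so a clopen set separates
  their zeros. Its extension to \<open>B\<close>, or the complement of this extension, cuts \<open>D\<close> down to a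
  neighbourhood of \<open>p\<close> that misses the zeros of one of the two functions.
\<close>

lemma Mc_ideal:
  assumes F: "countable_sets_have_gaps TYPE('f::{linordered_field,linorder_topology})"
    and p: "p \<in> topspace B"
  shows "ideal (Mc X B e p :: ('a \<Rightarrow> 'f) set) (Cc X)"
proof -
  interpret cring "Cc X :: ('a \<Rightarrow> 'f) ring" by (rule Cc_cring)
  show ?thesis
  proof (rule ideal_from_closure)
    show "Mc X B e p \<subseteq> carrier (Cc X)" by (auto simp: Mc_def)
    show "\<zero>\<^bsub>Cc X\<^esub> \<in> Mc X B e p"
      using trace_nonempty[of _ p] by (auto simp: Mc_iff[OF p] Cc_apply Cc_closed)
    show "x \<otimes>\<^bsub>Cc X\<^esub> a \<in> Mc X B e p" if a: "a \<in> Mc X B e p" and x: "x \<in> carrier (Cc X)" for a x :: "'a \<Rightarrow> 'f"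
      unfolding Mc_iff[OF p]
    proof (intro conjI allI impI)
      show "x \<otimes>\<^bsub>Cc X\<^esub> a \<in> carrier (Cc X)" using a x by (auto simp: Mc_iff[OF p] Cc_closed)
      fix D assume "openin B D \<and> closedin B D \<and> p \<in> D"
      then obtain y where "y \<in> topspace X" "e y \<in> D" "a y = 0"
        using a unfolding Mc_iff[OF p] by blast
      then show "\<exists>y\<in>topspace X. e y \<in> D \<and> (x \<otimes>\<^bsub>Cc X\<^esub> a) y = 0" by (auto simp: Cc_apply)
    qed
    fix f g :: "'a \<Rightarrow> 'f" assume fg: "f \<in> Mc X B e p" "g \<in> Mc X B e p"
    then have car: "f \<in> carrier (Cc X)" "g \<in> carrier (Cc X)" by (auto simp: Mc_def)
    show "f \<oplus>\<^bsub>Cc X\<^esub> g \<in> Mc X B e p"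
    proof (rule ccontr)
      assume "\<not> ?thesis"
      then obtain D where D: "openin B D" "closedin B D" "p \<in> D"
          "\<And>x. x \<in> trace D \<Longrightarrow> f x + g x \<noteq> 0"
        using car by (auto simp: Mc_iff[OF p] trace_def Cc_apply)
      have "\<exists>E. openin X E \<and> closedin X E \<and> trace D \<inter> Zc X f \<subseteq> E \<and> trace D \<inter> E \<inter> Zc X g = {}"
        using D(4) by (intro disjoint_zero_sets_separated[OF F car] trace_open trace_closed D) force
      then obtain E where E: "openin X E" "closedin X E" "trace D \<inter> Zc X f \<subseteq> E" "trace D \<inter> E \<inter> Zc X g = {}"
        by blast
      then obtain E' where E': "openin B E'" "closedin B E'" "\<forall>x\<in>topspace X. e x \<in> E' \<longleftrightarrow> x \<in> E"
        using clopen_extends by blast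
      show False
      proof (cases "p \<in> E'")
        case True
        then have "\<exists>x\<in>topspace X. e x \<in> D \<inter> E' \<and> g x = 0"
          using fg(2) D E' unfolding Mc_iff[OF p] by (meson IntI closedin_Int openin_Int)
        then show False using E(4) E'(3) by (auto simp: trace_def Zc_def)
      next
        case False
        then have "\<exists>x\<in>topspace X. e x \<in> D - E' \<and> f x = 0"
          using fg(1) D E' unfolding Mc_iff[OF p] by (meson DiffI closedin_diff openin_diff)
        then show False using E(3) E'(3) by (auto simp: trace_def Zc_def)
      qed
    qed
  qed
qed

text \<open>
  If a clopen set \<open>D\<close> contains \<open>p\<close> but not \<open>q\<close>, the function that is \<open>0\<close> on the trace of \<open>D\<close>
  and \<open>1\<close> elsewhere belongs to \<open>O\<^sup>p\<close> but not to \<open>M\<^sup>q\<close>.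
\<close>

lemma Oc_subset_Mc_imp_eq:
  assumes p: "p \<in> topspace B" and q: "q \<in> topspace B"
    and sub: "(Oc X B e p :: ('a \<Rightarrow> 'f::{linordered_field,linorder_topology}) set) \<subseteq> Mc X B e q"
  shows "p = q"
proof (rule ccontr)
  assume "p \<noteq> q"
  then obtain D where D: "openin B D" "closedin B D" "p \<in> D" "q \<notin> D"
    using separate_points p q by blast
  let ?f = "clopen_ind X (topspace X - trace D) :: 'a \<Rightarrow> 'f"
  have "?f \<in> Oc X B e p"
    unfolding Oc_iff using D
    by (auto simp: trace_def intro!: clopen_ind_in_Cc clopen_diff trace_open[unfolded trace_def] trace_closed[unfolded trace_def])
  then have "?f \<in> Mc X B e q" using sub by blast
  moreover have "openin B (topspace B - D)" "closedin B (topspace B - D)" using clopen_diff D by blast+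
  ultimately obtain x where "x \<in> topspace X" "e x \<in> topspace B - D" "?f x = 0"
    unfolding Mc_iff[OF q] using D(4) q by blast
  then show False by (auto simp: trace_def)
qed

text \<open>
  The zero sets of the members of \<open>I\<close> are directed downwards, since \<open>f\<^sup>2 + h\<^sup>2\<close> vanishes only where both
  \<open>f\<close> and \<open>h\<close> do. Compactness of \<open>K\<close> then gives a point of \<open>K\<close> in the closure of all of them.
  Taking for \<open>K\<close> a proper closed subset of \<open>B\<close> localizes the point, which is what the
  characterization of the ideals above \<open>O\<^sup>p\<close> needs.
\<close>

lemma ideal_subset_Mc:
  fixes I :: "('a \<Rightarrow> 'f::{linordered_field,linorder_topology}) set"
  assumes I: "ideal I (Cc X)" and K: "closedin B K"
    and meet: "\<And>f. f \<in> I \<Longrightarrow> K \<inter> B closure_of (e ` Zc X f) \<noteq> {}"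
  shows "\<exists>p\<in>K. I \<subseteq> Mc X B e p"
proof -
  interpret I: ideal I "Cc X" by fact
  have directed: "\<exists>h\<in>I. \<forall>f\<in>\<F>. Zc X h \<subseteq> Zc X f" if "finite \<F>" "\<F> \<subseteq> I" for \<F>
    using that
  proof (induction \<F>)
    case empty
    show ?case by (intro bexI[OF _ additive_subgroup.zero_closed[OF I.is_additive_subgroup]]) simp
  next
    case (insert f \<F>)
    then obtain h where h: "h \<in> I" "\<forall>f\<in>\<F>. Zc X h \<subseteq> Zc X f" by auto
    let ?k = "f \<otimes>\<^bsub>Cc X\<^esub> f \<oplus>\<^bsub>Cc X\<^esub> h \<otimes>\<^bsub>Cc X\<^esub> h"
    have "?k \<in> I" using h insert.prems by (intro additive_subgroup.a_closed[OF I.is_additive_subgroup] I.I_l_closed) auto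
    moreover have "Zc X ?k \<subseteq> Zc X f \<inter> Zc X h"
      by (auto simp: Zc_def Cc_apply sum_squares_eq_zero_iff)
    ultimately show ?case using h by blast
  qed
  have "compactin B K" using B_compact K closedin_compact_space by blast
  then have "K \<inter> \<Inter>((\<lambda>f. B closure_of (e ` Zc X f)) ` I) \<noteq> {}"
    unfolding compactin_fip
  proof (elim conjE allE impE)
    show "(\<forall>C\<in>(\<lambda>f. B closure_of (e ` Zc X f)) ` I. closedin B C) \<and>
      (\<forall>\<G>. finite \<G> \<and> \<G> \<subseteq> (\<lambda>f. B closure_of (e ` Zc X f)) ` I \<longrightarrow> K \<inter> \<Inter>\<G> \<noteq> {})"
    proof (intro conjI allI impI ballI; (elim conjE)?)
      fix \<G> assume "finite \<G>" "\<G> \<subseteq> (\<lambda>f. B closure_of (e ` Zc X f)) ` I"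
      then obtain \<F> where \<F>: "finite \<F>" "\<F> \<subseteq> I" "\<G> = (\<lambda>f. B closure_of (e ` Zc X f)) ` \<F>"
        by (meson finite_subset_image)
      then obtain h where h: "h \<in> I" "\<forall>f\<in>\<F>. Zc X h \<subseteq> Zc X f" using directed by blast
      then have "B closure_of (e ` Zc X h) \<subseteq> B closure_of (e ` Zc X f)" if "f \<in> \<F>" for f
        using that by (intro closure_of_mono image_mono) auto
      then show "K \<inter> \<Inter>\<G> \<noteq> {}" using meet[OF h(1)] \<F>(3) by blast
    qed auto
  qed
  then show ?thesis using I.a_subset by (auto simp: Mc_def)
qed

lemma proper_ideal_subset_Mc:
  assumes "proper_ideal I (Cc X)"
  shows "\<exists>p\<in>topspace B. I \<subseteq> Mc X B e p"
proof -
  interpret I: ideal I "Cc X" using assms by (simp add: proper_ideal_def)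
  have "Zc X f \<noteq> {}" if f: "f \<in> I" for f
  proof
    assume "Zc X f = {}"
    then obtain h where h: "h \<in> carrier (Cc X)" "h \<otimes>\<^bsub>Cc X\<^esub> f = clopen_ind X (topspace X)"
      using clopen_ind_multiple[of f X "topspace X"] f I.a_subset by (auto simp: Zc_def)
    moreover have "clopen_ind X (topspace X) = \<one>\<^bsub>Cc X\<^esub>"
      by (intro Cc_eqI[of _ X] clopen_ind_in_Cc Cc_closed) (auto simp: Cc_apply)
    ultimately have "\<one>\<^bsub>Cc X\<^esub> \<in> I" using f I.I_l_closed by metis
    then show False using assms I.one_imp_carrier by (simp add: proper_ideal_def)
  qed
  moreover have "e ` Zc X f \<subseteq> B closure_of (e ` Zc X f)" for f
    using e_in by (intro closure_of_subset) (auto simp: Zc_def)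
  ultimately have "topspace B \<inter> B closure_of (e ` Zc X f) \<noteq> {}" if "f \<in> I" for f
    using that closure_of_subset_topspace[of B "e ` Zc X f"] by fast
  then show ?thesis using ideal_subset_Mc[OF I.is_ideal closedin_topspace] by blast
qed

text \<open>
  Every proper ideal lies below some \<open>M\<^sup>p\<close>, and different \<open>M\<^sup>p\<close> are incomparable, because
  \<open>M\<^sup>p \<subseteq> M\<^sup>q\<close> implies \<open>O\<^sup>p \<subseteq> M\<^sup>q\<close> and hence \<open>p = q\<close>.
\<close>

lemma maximalideal_iff_Mc:
  assumes F: "countable_sets_have_gaps TYPE('f::{linordered_field,linorder_topology})"
  shows "maximalideal M (Cc X :: ('a \<Rightarrow> 'f) ring) \<longleftrightarrow> (\<exists>p\<in>topspace B. M = Mc X B e p)"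
proof
  assume "maximalideal M (Cc X)"
  then interpret M: maximalideal M "Cc X" .
  have "proper_ideal M (Cc X)" using M.is_ideal M.I_notcarr by (simp add: proper_ideal_def)
  then obtain p where p: "p \<in> topspace B" "M \<subseteq> Mc X B e p" using proper_ideal_subset_Mc by blast
  have "Mc X B e p \<subseteq> carrier (Cc X :: ('a \<Rightarrow> 'f) ring)" by (auto simp: Mc_def)
  then have "Mc X B e p = M \<or> Mc X B e p = carrier (Cc X :: ('a \<Rightarrow> 'f) ring)"
    by (rule M.I_maximal[OF Mc_ideal[OF F p(1)] p(2)])
  then show "\<exists>p\<in>topspace B. M = Mc X B e p"
    using p(1) one_notin_Mc Cc_closed(3) by metis
next
  assume "\<exists>p\<in>topspace B. M = Mc X B e p"
  then obtain p where p: "p \<in> topspace B" "M = Mc X B e p" by blast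
  show "maximalideal M (Cc X)"
  proof (rule maximalidealI)
    show "ideal M (Cc X)" using Mc_ideal[OF F p(1)] p(2) by simp
    show "carrier (Cc X) \<noteq> M" using one_notin_Mc p(2) Cc_closed(3) by metis
    fix J :: "('a \<Rightarrow> 'f) set" assume J: "ideal J (Cc X)" "M \<subseteq> J" "J \<subseteq> carrier (Cc X)"
    show "J = M \<or> J = carrier (Cc X)"
    proof (rule ccontr)
      assume n: "\<not> ?thesis"
      then have "proper_ideal J (Cc X)" using J(1) by (simp add: proper_ideal_def)
      then obtain q where q: "q \<in> topspace B" "J \<subseteq> Mc X B e q"
        using proper_ideal_subset_Mc by blast
      have "(Oc X B e p :: ('a \<Rightarrow> 'f) set) \<subseteq> Mc X B e q"
        using Oc_subset_Mc[OF p(1)] J(2) q(2) unfolding p(2) by (meson order_trans)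
      then have "p = q" by (rule Oc_subset_Mc_imp_eq[OF p(1) q(1)])
      then show False using n J(2) q(2) p(2) by blast
    qed
  qed
qed

text \<open>
  Let \<open>f\<close> vanish on the trace of a clopen set \<open>D\<close> around \<open>p\<close>. No point outside \<open>D\<close> belongs to the
  closures of all zero sets of \<open>I\<close>, so by compactness one member \<open>h\<close> of \<open>I\<close> has all its zeros in
  the trace of \<open>D\<close>. The indicator of the complement of that trace is a multiple of \<open>h\<close>, and
  \<open>f\<close> is a multiple of this indicator.
\<close>

lemma Oc_subset_if_unique_Mc:
  fixes I :: "('a \<Rightarrow> 'f::{linordered_field,linorder_topology}) set"
  assumes I: "ideal I (Cc X)"
    and uniq: "\<And>q. q \<in> topspace B \<Longrightarrow> I \<subseteq> Mc X B e q \<Longrightarrow> q = p"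
  shows "Oc X B e p \<subseteq> I"
proof
  interpret I: ideal I "Cc X" by fact
  fix f :: "'a \<Rightarrow> 'f" assume "f \<in> Oc X B e p"
  then obtain D where f: "f \<in> carrier (Cc X)"
      and D: "openin B D" "closedin B D" "p \<in> D" "\<forall>x\<in>trace D. f x = 0"
    unfolding Oc_iff by blast
  have "\<not> (\<exists>q\<in>topspace B - D. I \<subseteq> Mc X B e q)" using uniq D(3) by blast
  then obtain h where h: "h \<in> I" "(topspace B - D) \<inter> B closure_of (e ` Zc X h) = {}"
    using ideal_subset_Mc[OF I, of "topspace B - D"] D(1) by blast
  have hc: "h \<in> carrier (Cc X)" using h(1) I.a_subset by blast
  have C: "openin X (topspace X - trace D)" "closedin X (topspace X - trace D)"
    by (rule clopen_diff[OF trace_open[OF D(1)] trace_closed[OF D(2)]])+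
  have "e ` Zc X h \<subseteq> B closure_of (e ` Zc X h)"
    using e_in by (intro closure_of_subset) (auto simp: Zc_def)
  then have "h x \<noteq> 0" if "x \<in> topspace X - trace D" for x
    using h(2) that e_in by (auto simp: trace_def Zc_def)
  then obtain k where k: "k \<in> carrier (Cc X)" "k \<otimes>\<^bsub>Cc X\<^esub> h = clopen_ind X (topspace X - trace D)"
    using clopen_ind_multiple[OF hc C] by blast
  then have ind: "clopen_ind X (topspace X - trace D) \<in> I" using I.I_l_closed[OF h(1) k(1)] by simp
  have "f = f \<otimes>\<^bsub>Cc X\<^esub> clopen_ind X (topspace X - trace D)"
    by (rule Cc_eqI[OF f Cc_closed(1)[OF f clopen_ind_in_Cc[OF C]]]) (use D(4) in \<open>auto simp: Cc_apply\<close>)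
  then show "f \<in> I" using I.I_l_closed[OF ind f] by simp
qed

lemma unique_maximal_iff_Oc_subset:
  assumes F: "countable_sets_have_gaps TYPE('f::{linordered_field,linorder_topology})"
    and I: "proper_ideal I (Cc X :: ('a \<Rightarrow> 'f) ring)"
  shows "(\<exists>!M. maximalideal M (Cc X) \<and> I \<subseteq> M) \<longleftrightarrow> (\<exists>p\<in>topspace B. Oc X B e p \<subseteq> I)"
proof
  assume uniq: "\<exists>!M. maximalideal M (Cc X) \<and> I \<subseteq> M"
  obtain p where p: "p \<in> topspace B" "I \<subseteq> Mc X B e p" using proper_ideal_subset_Mc[OF I] by blast
  have "q = p" if q: "q \<in> topspace B" "I \<subseteq> Mc X B e q" for q
  proof -
    have "Mc X B e q = (Mc X B e p :: ('a \<Rightarrow> 'f) set)"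
      using uniq p q maximalideal_iff_Mc[OF F] by blast
    then show ?thesis using Oc_subset_Mc_imp_eq[OF q(1) p(1)] Oc_subset_Mc[OF q(1)] by blast
  qed
  then show "\<exists>p\<in>topspace B. Oc X B e p \<subseteq> I"
    using Oc_subset_if_unique_Mc[of I p] I p(1) by (auto simp: proper_ideal_def)
next
  assume "\<exists>p\<in>topspace B. Oc X B e p \<subseteq> I"
  then obtain p where p: "p \<in> topspace B" "Oc X B e p \<subseteq> I" by blast
  have "q = p" if "q \<in> topspace B" "I \<subseteq> Mc X B e q" for q
    using Oc_subset_Mc_imp_eq[OF p(1) that(1)] p(2) that(2) by blast
  then show "\<exists>!M. maximalideal M (Cc X) \<and> I \<subseteq> M"
    using proper_ideal_subset_Mc[OF I] maximalideal_iff_Mc[OF F] by metis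
qed

text \<open>
  The annihilating function can be taken to be the indicator of a trace on which \<open>f\<close> vanishes.
  Conversely, a function outside \<open>M\<^sup>p\<close> has no zeros in the trace of some clopen set around \<open>p\<close>,
  so whatever it annihilates must vanish there.
\<close>

lemma Oc_iff_annihilated:
  fixes f :: "'a \<Rightarrow> 'f::{linordered_field,linorder_topology}"
  assumes p: "p \<in> topspace B" and f: "f \<in> carrier (Cc X)"
  shows "f \<in> Oc X B e p \<longleftrightarrow> (\<exists>g\<in>carrier (Cc X) - Mc X B e p. f \<otimes>\<^bsub>Cc X\<^esub> g = \<zero>\<^bsub>Cc X\<^esub>)"
proof
  assume "f \<in> Oc X B e p"
  then obtain D where D: "openin B D" "closedin B D" "p \<in> D" "\<forall>x\<in>trace D. f x = 0"
    unfolding Oc_iff by blast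
  let ?g = "clopen_ind X (trace D) :: 'a \<Rightarrow> 'f"
  have g: "?g \<in> carrier (Cc X)" by (intro clopen_ind_in_Cc trace_open trace_closed D)
  moreover have "?g \<notin> Mc X B e p" unfolding Mc_iff[OF p] using D by (auto simp: trace_def)
  moreover have "f \<otimes>\<^bsub>Cc X\<^esub> ?g = \<zero>\<^bsub>Cc X\<^esub>"
    by (rule Cc_eqI[OF Cc_closed(1)[OF f g] Cc_closed(4)]) (use D(4) in \<open>auto simp: Cc_apply\<close>)
  ultimately show "\<exists>g\<in>carrier (Cc X) - Mc X B e p. f \<otimes>\<^bsub>Cc X\<^esub> g = \<zero>\<^bsub>Cc X\<^esub>" by blast
next
  assume "\<exists>g\<in>carrier (Cc X) - Mc X B e p. f \<otimes>\<^bsub>Cc X\<^esub> g = \<zero>\<^bsub>Cc X\<^esub>"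
  then obtain g where g: "g \<in> carrier (Cc X)" "g \<notin> Mc X B e p" "f \<otimes>\<^bsub>Cc X\<^esub> g = \<zero>\<^bsub>Cc X\<^esub>" by blast
  then obtain D where D: "openin B D" "closedin B D" "p \<in> D" "\<forall>x\<in>topspace X. e x \<in> D \<longrightarrow> g x \<noteq> 0"
    unfolding Mc_iff[OF p] by blast
  have "f x * g x = 0" if "x \<in> topspace X" for x
    using fun_cong[OF g(3), of x] that by (simp add: Cc_apply)
  then show "f \<in> Oc X B e p" unfolding Oc_iff using f D by (auto simp: trace_def)
qed

lemma Oc_zo_ideal:
  assumes "p \<in> topspace B"
  shows "zo_ideal (Oc X B e p) (Cc X)"
  unfolding zo_ideal_def
proof (intro conjI ballI subsetI)
  show "proper_ideal (Oc X B e p) (Cc X)" by (rule Oc_proper[OF assms])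
  fix a b assume "a \<in> Oc X B e p" and b: "b \<in> minimal_prime_hull (Cc X) a"
  then obtain D where a: "a \<in> carrier (Cc X)"
      and D: "openin B D" "closedin B D" "p \<in> D" "\<And>x. x \<in> trace D \<Longrightarrow> a x = 0"
    unfolding Oc_iff by blast
  have "b x = 0" if "x \<in> trace D" for x
    using minimal_prime_hull_vanishes[OF a b trace_open[OF D(1)] trace_closed[OF D(2)] D(4) that] .
  moreover have "b \<in> carrier (Cc X)" using b by (simp add: minimal_prime_hull_def)
  ultimately show "b \<in> Oc X B e p" unfolding Oc_iff using D by blast
qed

text \<open>
  A common zero \<open>x\<close> of \<open>O\<^sup>p\<close> forces \<open>O\<^sup>p \<subseteq> M\<^sup>q\<close> for the point \<open>q\<close> of \<open>B\<close> corresponding to \<open>x\<close>,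
  hence \<open>p = q\<close>.
\<close>

lemma Oc_fixed_iff:
  assumes p: "p \<in> topspace B"
  shows "fixed_ideal (Oc X B e p :: ('a \<Rightarrow> 'f::{linordered_field,linorder_topology}) set) X
     \<longleftrightarrow> p \<in> e ` topspace X"
proof
  assume "p \<in> e ` topspace X"
  then obtain x where x: "x \<in> topspace X" "p = e x" by blast
  then have "x \<in> Zc X f" if "f \<in> Oc X B e p" for f :: "'a \<Rightarrow> 'f"
    using that unfolding Oc_iff by (auto simp: trace_def Zc_def)
  then show "fixed_ideal (Oc X B e p :: ('a \<Rightarrow> 'f) set) X"
    unfolding fixed_ideal_def using Oc_proper[OF p] x(1) by blast
next
  assume "fixed_ideal (Oc X B e p :: ('a \<Rightarrow> 'f) set) X"
  then obtain x where x: "x \<in> topspace X" "\<And>f :: 'a \<Rightarrow> 'f. f \<in> Oc X B e p \<Longrightarrow> f x = 0"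
    unfolding fixed_ideal_def by (auto simp: Zc_def)
  have "(Oc X B e p :: ('a \<Rightarrow> 'f) set) \<subseteq> Mc X B e (e x)"
  proof
    fix f :: "'a \<Rightarrow> 'f" assume f: "f \<in> Oc X B e p"
    then have "f \<in> carrier (Cc X)" by (simp add: Oc_def)
    then show "f \<in> Mc X B e (e x)" using x(1) x(2)[OF f] by (auto simp: Mc_iff[OF e_in[OF x(1)]])
  qed
  then have "p = e x" by (rule Oc_subset_Mc_imp_eq[OF p e_in[OF x(1)]])
  then show "p \<in> e ` topspace X" using x(1) by blast
qed

end

lemma banaschewski_zero_dim_compactification:
  assumes X: "zero_dimensional_space X" and B: "banaschewski X B e"
  shows "zero_dim_compactification X B e"
proof
  have emb: "embedding_map X B e" using B by (simp add: banaschewski_def)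
  show "continuous_map X B e" using emb
    unfolding embedding_map_def
    by (rule continuous_map_into_fulltopology[OF homeomorphic_imp_continuous_map])
  show "inj_on e (topspace X)" using emb
    unfolding embedding_map_def by (rule homeomorphic_imp_injective_map)
  then have e_B: "e x \<in> topspace B" if "x \<in> topspace X" for x
    using \<open>continuous_map X B e\<close> that by (auto simp: continuous_map_def)
  fix C assume C: "openin X C" "closedin X C"
  let ?Y = "discrete_topology (UNIV :: bool set)"
  have "{x \<in> topspace X. (x \<in> C) \<in> U} =
      (if True \<in> U then C else {}) \<union> (if False \<in> U then topspace X - C else {})" for U
    using openin_subset[OF C(1)] by auto metis+
  then have "continuous_map X ?Y (\<lambda>x. x \<in> C)"
    using C by (auto simp: continuous_map_def openin_diff)
  then obtain g where g: "continuous_map B ?Y g" "\<forall>x\<in>topspace X. g (e x) = (x \<in> C)"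
    using banaschewski_extension[OF B, of ?Y "\<lambda>x. x \<in> C"]
    by (auto simp: compact_space_discrete_topology zero_dimensional_space_discrete)
  have "openin B {b \<in> topspace B. g b \<in> {True}}" "closedin B {b \<in> topspace B. g b \<in> {True}}"
    by (rule openin_continuous_map_preimage[OF g(1)] closedin_continuous_map_preimage[OF g(1)]; simp)+
  then show "\<exists>D. openin B D \<and> closedin B D \<and> (\<forall>x\<in>topspace X. e x \<in> D \<longleftrightarrow> x \<in> C)"
    using g(2) e_B by (intro exI[of _ "{b \<in> topspace B. g b \<in> {True}}"]) auto
qed (use X B in \<open>auto simp: banaschewski_def\<close>)

theorem theorem3p1:
  fixes X :: "'a topology" and B :: "'b topology" and e :: "'a \<Rightarrow> 'b"
  assumes F: "uncountable (UNIV :: 'f::{linordered_field,linorder_topology} set) \<or>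
      (countable (UNIV :: 'f set) \<and> real_subfield TYPE('f))"
    and X: "Hausdorff_space X" "zero_dimensional_space X"
    and B: "banaschewski X B e"
  shows
    "(\<forall>p\<in>topspace B.
        Z_Fc_ideal (Oc X B e p :: ('a \<Rightarrow> 'f) set) X \<and>
        (Oc X B e p :: ('a \<Rightarrow> 'f) set) \<subseteq> Mc X B e p) \<and>
     (\<forall>p\<in>topspace B.
        (Oc X B e p :: ('a \<Rightarrow> 'f) set) =
          {f \<in> carrier (Cc X). \<exists>V. openin B V \<and> p \<in> V \<and> V \<inter> e ` topspace X \<subseteq> e ` Zc X f}) \<and>
     (\<forall>p\<in>topspace B.
        (\<forall>f\<in>carrier (Cc X :: ('a \<Rightarrow> 'f) ring).
           f \<in> Oc X B e p \<longleftrightarrow>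
             (\<exists>g\<in>carrier (Cc X) - Mc X B e p. f \<otimes>\<^bsub>Cc X\<^esub> g = \<zero>\<^bsub>Cc X\<^esub>)) \<and>
        (\<forall>f\<in>(Oc X B e p :: ('a \<Rightarrow> 'f) set). f \<noteq> \<zero>\<^bsub>Cc X\<^esub> \<longrightarrow> zero_divisor (Cc X) f) \<and>
        zo_ideal (Oc X B e p :: ('a \<Rightarrow> 'f) set) (Cc X)) \<and>
     (\<forall>I. proper_ideal I (Cc X :: ('a \<Rightarrow> 'f) ring) \<longrightarrow>
        ((\<exists>!M. maximalideal M (Cc X) \<and> I \<subseteq> M) \<longleftrightarrow>
         (\<exists>p\<in>topspace B. Oc X B e p \<subseteq> I))) \<and>
     (\<forall>p\<in>topspace B.
        fixed_ideal (Oc X B e p :: ('a \<Rightarrow> 'f) set) X \<longleftrightarrow> p \<in> e ` topspace X)"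
proof -
  have F': "countable_sets_have_gaps TYPE('f)"
    using F countable_sets_have_gaps_uncountable countable_sets_have_gaps_real_subfield by blast
  interpret zero_dim_compactification X B e
    by (rule banaschewski_zero_dim_compactification[OF X(2) B])
  have zero_div: "zero_divisor (Cc X) f"
    if p: "p \<in> topspace B" and f: "f \<in> Oc X B e p" for p and f :: "'a \<Rightarrow> 'f"
  proof -
    have fc: "f \<in> carrier (Cc X)" using f by (simp add: Oc_def)
    then obtain g where g: "g \<in> carrier (Cc X) - Mc X B e p" "f \<otimes>\<^bsub>Cc X\<^esub> g = \<zero>\<^bsub>Cc X\<^esub>"
      using Oc_iff_annihilated[OF p] f by blast
    have "\<zero>\<^bsub>Cc X\<^esub> \<in> (Mc X B e p :: ('a \<Rightarrow> 'f) set)"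
      using additive_subgroup.zero_closed[OF ideal.axioms(1)[OF Oc_ideal[OF p]]] Oc_subset_Mc[OF p] by blast
    then have "g \<noteq> \<zero>\<^bsub>Cc X\<^esub>" using g(1) by auto
    then show ?thesis using g fc by (auto simp: zero_divisor_def)
  qed
  have Z_ideal: "Z_Fc_ideal (Oc X B e p :: ('a \<Rightarrow> 'f) set) X" if p: "p \<in> topspace B" for p
    unfolding Z_Fc_ideal_def using Oc_proper[OF p] by (auto simp: Oc_def)
  have trace: "V \<inter> e ` topspace X \<subseteq> e ` Zc X f \<longleftrightarrow> (\<forall>x\<in>trace V. f x = 0)" for V and f :: "'a \<Rightarrow> 'f"
    using e_inj by (fastforce simp: trace_def Zc_def inj_on_def)
  show ?thesis
    by (intro conjI ballI allI impI Z_ideal Oc_subset_Mc Oc_iff_annihilated zero_div Oc_zo_ideal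
        unique_maximal_iff_Oc_subset[OF F'] Oc_fixed_iff)
      (auto simp: Oc_eq_open trace)
qed

end
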